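(* Let $(\mathcal{B},\mathcal{A},i,e,l)$ be a cleft extension of abelian categories such that $i$ preserves coproducts, and let $q:\mathcal{A}\to\mathcal{B}$ be the left adjoint of $i$. Let $A$ be an object of $\mathcal{A}$ and let $l(P_1)\xrightarrow{\delta}l(P_0)\to A\to0$ be a projective presentation of $A$, with $P_0,P_1$ projective in $\mathcal{B}$. If $A$ is silting (respectively, partial silting) with respect to $\delta$, then $q(A)$ is silting (respectively, partial silting) with respect to $q(\delta)$, where $q(\delta)$ is regarded as a morphism $P_1\to P_0$ via $ql\simeq\mathrm{Id}_{\mathcal{B}}$ and gives the projective presentation $P_1\xrightarrow{q(\delta)}P_0\to q(A)\to0$ of $q(A)$.
   Context: Standing assumptions: $\mathcal{A}$ and $\mathcal{B}$ are abelian categories with enough projective and enough injective objects, and with set-indexed coproducts. Cleft extension: a cleft extension $(\mathcal{B},\mathcal{A},i,e,l)$ of $\mathcal{B}$ consists of an abelian category $\mathcal{A}$ and functors $i:\mathcal{B}\to\mathcal{A}$, $e:\mathcal{A}\to\mathcal{B}$, $l:\mathcal{B}\to\mathcal{A}$ such that $e$ is faithful and exact, $l$ is left adjoint to $e$, and there is a natural isomorphism $ei\simeq \mathrm{Id}_{\mathcal{B}}$. It is known that then $i$ is fully faithful and exact and has a left adjoint $q:\mathcal{A}\to\mathcal{B}$, and $ql\simeq\mathrm{Id}_{\mathcal{B}}$. For a morphism $\sigma:X\to Y$ in an abelian category $\mathcal{C}$, $\mathcal{D}_\sigma$ is the class of objects $L$ of $\mathcal{C}$ such that $\operatorname{Hom}_{\mathcal{C}}(\sigma,L):\operatorname{Hom}_{\mathcal{C}}(Y,L)\to\operatorname{Hom}_{\mathcal{C}}(X,L)$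 is surjective. $\operatorname{Gen}(X)$ is the class of quotients of coproducts of copies of $X$. A projective presentation of $X$ is an exact sequence $Q_1\xrightarrow{\sigma}Q_0\to X\to0$ with $Q_0,Q_1$ projective. Given such a presentation, $X$ is partial silting with respect to $\sigma$ if $X\in\mathcal{D}_\sigma$ and $\mathcal{D}_\sigma$ is a torsion class (equivalently, since $\mathcal{D}_\sigma$ is automatically closed under epimorphic images and extensions, $\mathcal{D}_\sigma$ is closed under coproducts). $X$ is silting with respect to $\sigma$ if $\operatorname{Gen}(X)=\mathcal{D}_\sigma$. *)

theory Defs
  imports "HOL-Algebra.Group"
begin

section \<open>Categories\<close>

record ('o, 'm) cat =
  Obj :: "'o set"
  Arr :: "'m set"
  Dom :: "'m \<Rightarrow> 'o"
  Cod :: "'m \<Rightarrow> 'o"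
  Ident :: "'o \<Rightarrow> 'm"
  Comp :: "'m \<Rightarrow> 'm \<Rightarrow> 'm" (infixl "\<cdot>\<index>" 70)

definition Hom :: "('o, 'm) cat \<Rightarrow> 'o \<Rightarrow> 'o \<Rightarrow> 'm set" where
  "Hom C X Y = {f \<in> Arr C. Dom C f = X \<and> Cod C f = Y}"

locale category =
  fixes C :: "('o, 'm) cat" (structure)
  assumes Dom_in_Obj: "f \<in> Arr C \<Longrightarrow> Dom C f \<in> Obj C"
    and Cod_in_Obj: "f \<in> Arr C \<Longrightarrow> Cod C f \<in> Obj C"
    and Ident_in_Hom: "X \<in> Obj C \<Longrightarrow> Ident C X \<in> Hom C X X"
    and Comp_in_Hom: "f \<in> Hom C X Y \<Longrightarrow> g \<in> Hom C Y Z \<Longrightarrow> g \<cdot> f \<in> Hom C X Z"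
    and Ident_right: "f \<in> Hom C X Y \<Longrightarrow> f \<cdot> Ident C X = f"
    and Ident_left: "f \<in> Hom C X Y \<Longrightarrow> Ident C Y \<cdot> f = f"
    and Comp_assoc: "f \<in> Hom C W X \<Longrightarrow> g \<in> Hom C X Y \<Longrightarrow> h \<in> Hom C Y Z \<Longrightarrow>
      (h \<cdot> g) \<cdot> f = h \<cdot> (g \<cdot> f)"

definition is_mono :: "('o, 'm) cat \<Rightarrow> 'm \<Rightarrow> bool" where
  "is_mono C f \<longleftrightarrow> f \<in> Arr C \<and>
     (\<forall>W \<in> Obj C. \<forall>g \<in> Hom C W (Dom C f). \<forall>h \<in> Hom C W (Dom C f).
        f \<cdot>\<^bsub>C\<^esub> g = f \<cdot>\<^bsub>C\<^esub> h \<longrightarrow> g = h)"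

definition is_epi :: "('o, 'm) cat \<Rightarrow> 'm \<Rightarrow> bool" where
  "is_epi C f \<longleftrightarrow> f \<in> Arr C \<and>
     (\<forall>Z \<in> Obj C. \<forall>g \<in> Hom C (Cod C f) Z. \<forall>h \<in> Hom C (Cod C f) Z.
        g \<cdot>\<^bsub>C\<^esub> f = h \<cdot>\<^bsub>C\<^esub> f \<longrightarrow> g = h)"

definition inverse_arrows :: "('o, 'm) cat \<Rightarrow> 'm \<Rightarrow> 'm \<Rightarrow> bool" where
  "inverse_arrows C f g \<longleftrightarrow> f \<in> Arr C \<and> g \<in> Hom C (Cod C f) (Dom C f) \<and>
     g \<cdot>\<^bsub>C\<^esub> f = Ident C (Dom C f) \<and> f \<cdot>\<^bsub>C\<^esub> g = Ident C (Cod C f)"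

definition is_iso :: "('o, 'm) cat \<Rightarrow> 'm \<Rightarrow> bool" where
  "is_iso C f \<longleftrightarrow> (\<exists>g. inverse_arrows C f g)"

definition inv_arr :: "('o, 'm) cat \<Rightarrow> 'm \<Rightarrow> 'm" where
  "inv_arr C f = (THE g. inverse_arrows C f g)"

section \<open>Abelian categories\<close>

definition zero_object :: "('o, 'm) cat \<Rightarrow> 'o \<Rightarrow> bool" where
  "zero_object C Z \<longleftrightarrow> Z \<in> Obj C \<and>
     (\<forall>X \<in> Obj C. (\<exists>!f. f \<in> Hom C Z X) \<and> (\<exists>!f. f \<in> Hom C X Z))"

definition zero_arrow :: "('o, 'm) cat \<Rightarrow> 'm \<Rightarrow> bool" where
  "zero_arrow C f \<longleftrightarrow> f \<in> Arr C \<and>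
     (\<exists>Z. zero_object C Z \<and>
       (\<exists>g \<in> Hom C (Dom C f) Z. \<exists>h \<in> Hom C Z (Cod C f). f = h \<cdot>\<^bsub>C\<^esub> g))"

definition is_kernel :: "('o, 'm) cat \<Rightarrow> 'm \<Rightarrow> 'm \<Rightarrow> bool" where
  "is_kernel C f k \<longleftrightarrow> f \<in> Arr C \<and> k \<in> Arr C \<and> Cod C k = Dom C f \<and> zero_arrow C (f \<cdot>\<^bsub>C\<^esub> k) \<and>
     (\<forall>W \<in> Obj C. \<forall>g \<in> Hom C W (Dom C f). zero_arrow C (f \<cdot>\<^bsub>C\<^esub> g) \<longrightarrow>
        (\<exists>!h. h \<in> Hom C W (Dom C k) \<and> k \<cdot>\<^bsub>C\<^esub> h = g))"

definition is_cokernel :: "('o, 'm) cat \<Rightarrow> 'm \<Rightarrow> 'm \<Rightarrow> bool" where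
  "is_cokernel C f c \<longleftrightarrow> f \<in> Arr C \<and> c \<in> Arr C \<and> Dom C c = Cod C f \<and> zero_arrow C (c \<cdot>\<^bsub>C\<^esub> f) \<and>
     (\<forall>W \<in> Obj C. \<forall>g \<in> Hom C (Cod C f) W. zero_arrow C (g \<cdot>\<^bsub>C\<^esub> f) \<longrightarrow>
        (\<exists>!h. h \<in> Hom C (Cod C c) W \<and> h \<cdot>\<^bsub>C\<^esub> c = g))"

definition is_binary_product :: "('o, 'm) cat \<Rightarrow> 'o \<Rightarrow> 'o \<Rightarrow> 'o \<Rightarrow> 'm \<Rightarrow> 'm \<Rightarrow> bool" where
  "is_binary_product C X Y S p r \<longleftrightarrow> S \<in> Obj C \<and> p \<in> Hom C S X \<and> r \<in> Hom C S Y \<and>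
     (\<forall>W \<in> Obj C. \<forall>f \<in> Hom C W X. \<forall>g \<in> Hom C W Y.
        \<exists>!h. h \<in> Hom C W S \<and> p \<cdot>\<^bsub>C\<^esub> h = f \<and> r \<cdot>\<^bsub>C\<^esub> h = g)"

definition preadditive :: "('o, 'm) cat \<Rightarrow> ('m \<Rightarrow> 'm \<Rightarrow> 'm) \<Rightarrow> ('o \<Rightarrow> 'o \<Rightarrow> 'm) \<Rightarrow> bool" where
  "preadditive C add zero \<longleftrightarrow>
     (\<forall>X \<in> Obj C. \<forall>Y \<in> Obj C.
        comm_group \<lparr>carrier = Hom C X Y, mult = add, one = zero X Y\<rparr>) \<and>
     (\<forall>X \<in> Obj C. \<forall>Y \<in> Obj C. \<forall>Z \<in> Obj C.
        \<forall>f \<in> Hom C X Y. \<forall>f' \<in> Hom C X Y. \<forall>g \<in> Hom C Y Z. \<forall>g' \<in> Hom C Y Z.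
          g \<cdot>\<^bsub>C\<^esub> add f f' = add (g \<cdot>\<^bsub>C\<^esub> f) (g \<cdot>\<^bsub>C\<^esub> f') \<and>
          add g g' \<cdot>\<^bsub>C\<^esub> f = add (g \<cdot>\<^bsub>C\<^esub> f) (g' \<cdot>\<^bsub>C\<^esub> f))"

text \<open>In an abelian category the addition of morphisms is determined by the underlying
  category, so it is not part of the data.  Binary products together with a zero object
  and the enrichment yield binary biproducts.\<close>

definition abelian_category :: "('o, 'm) cat \<Rightarrow> bool" where
  "abelian_category C \<longleftrightarrow> category C \<and>
     (\<exists>add zero. preadditive C add zero) \<and>
     (\<exists>Z. zero_object C Z) \<and>
     (\<forall>X \<in> Obj C. \<forall>Y \<in> Obj C. \<exists>S p r. is_binary_product C X Y S p r) \<and>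
     (\<forall>f \<in> Arr C. (\<exists>k. is_kernel C f k) \<and> (\<exists>c. is_cokernel C f c)) \<and>
     (\<forall>k. is_mono C k \<longrightarrow> (\<exists>f. is_kernel C f k)) \<and>
     (\<forall>c. is_epi C c \<longrightarrow> (\<exists>f. is_cokernel C f c))"

text \<open>Exactness of \<open>f\<close> followed by \<open>g\<close> at the middle object: the image of \<open>f\<close>, that is, the
  kernel of its cokernel, is a kernel of \<open>g\<close>.\<close>

definition exact_at :: "('o, 'm) cat \<Rightarrow> 'm \<Rightarrow> 'm \<Rightarrow> bool" where
  "exact_at C f g \<longleftrightarrow> (\<exists>c k. is_cokernel C f c \<and> is_kernel C c k \<and> is_kernel C g k)"

definition short_exact :: "('o, 'm) cat \<Rightarrow> 'm \<Rightarrow> 'm \<Rightarrow> bool" where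
  "short_exact C f g \<longleftrightarrow> is_mono C f \<and> exact_at C f g \<and> is_epi C g"

definition projective :: "('o, 'm) cat \<Rightarrow> 'o \<Rightarrow> bool" where
  "projective C P \<longleftrightarrow> P \<in> Obj C \<and>
     (\<forall>g. is_epi C g \<longrightarrow> (\<forall>f \<in> Hom C P (Cod C g). \<exists>h \<in> Hom C P (Dom C g). g \<cdot>\<^bsub>C\<^esub> h = f))"

definition injective :: "('o, 'm) cat \<Rightarrow> 'o \<Rightarrow> bool" where
  "injective C E \<longleftrightarrow> E \<in> Obj C \<and>
     (\<forall>g. is_mono C g \<longrightarrow> (\<forall>f \<in> Hom C (Dom C g) E. \<exists>h \<in> Hom C (Cod C g) E. h \<cdot>\<^bsub>C\<^esub> g = f))"

definition enough_projectives :: "('o, 'm) cat \<Rightarrow> bool" where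
  "enough_projectives C \<longleftrightarrow>
     (\<forall>X \<in> Obj C. \<exists>P p. projective C P \<and> p \<in> Hom C P X \<and> is_epi C p)"

definition enough_injectives :: "('o, 'm) cat \<Rightarrow> bool" where
  "enough_injectives C \<longleftrightarrow>
     (\<forall>X \<in> Obj C. \<exists>E j. injective C E \<and> j \<in> Hom C X E \<and> is_mono C j)"

section \<open>Set-indexed coproducts\<close>

definition is_coproduct ::
  "('o, 'm) cat \<Rightarrow> 'i set \<Rightarrow> ('i \<Rightarrow> 'o) \<Rightarrow> 'o \<Rightarrow> ('i \<Rightarrow> 'm) \<Rightarrow> bool" where
  "is_coproduct C I X S \<iota> \<longleftrightarrow> S \<in> Obj C \<and> (\<forall>j \<in> I. X j \<in> Obj C \<and> \<iota> j \<in> Hom C (X j) S) \<and>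
     (\<forall>Y \<in> Obj C. \<forall>g. (\<forall>j \<in> I. g j \<in> Hom C (X j) Y) \<longrightarrow>
        (\<exists>!h. h \<in> Hom C S Y \<and> (\<forall>j \<in> I. h \<cdot>\<^bsub>C\<^esub> \<iota> j = g j)))"

text \<open>The collection \<open>U\<close> specifies which index sets count as sets as opposed to proper
  classes.  It is an arbitrary parameter throughout: with \<open>U = UNIV\<close> all subsets of the index
  type are allowed, and if the index type has the cardinality of a Grothendieck universe, the
  subsets of smaller cardinality represent exactly the small sets up to bijection.\<close>

definition has_coproducts :: "'i set set \<Rightarrow> ('o, 'm) cat \<Rightarrow> bool" where
  "has_coproducts U C \<longleftrightarrow>
     (\<forall>I \<in> U. \<forall>X. (\<forall>j \<in> I. X j \<in> Obj C) \<longrightarrow> (\<exists>S \<iota>. is_coproduct C I X S \<iota>))"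

section \<open>Functors and adjunctions\<close>

record ('o1, 'm1, 'o2, 'm2) fctr =
  fobj :: "'o1 \<Rightarrow> 'o2"
  farr :: "'m1 \<Rightarrow> 'm2"

definition is_functor ::
  "('o1, 'm1) cat \<Rightarrow> ('o2, 'm2) cat \<Rightarrow> ('o1, 'm1, 'o2, 'm2) fctr \<Rightarrow> bool" where
  "is_functor C D F \<longleftrightarrow> category C \<and> category D \<and>
     (\<forall>X \<in> Obj C. fobj F X \<in> Obj D \<and> farr F (Ident C X) = Ident D (fobj F X)) \<and>
     (\<forall>X \<in> Obj C. \<forall>Y \<in> Obj C. \<forall>f \<in> Hom C X Y. farr F f \<in> Hom D (fobj F X) (fobj F Y)) \<and>
     (\<forall>X \<in> Obj C. \<forall>Y \<in> Obj C. \<forall>Z \<in> Obj C. \<forall>f \<in> Hom C X Y. \<forall>g \<in> Hom C Y Z.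
        farr F (g \<cdot>\<^bsub>C\<^esub> f) = farr F g \<cdot>\<^bsub>D\<^esub> farr F f)"

definition id_functor :: "('o, 'm, 'o, 'm) fctr" where
  "id_functor = \<lparr>fobj = \<lambda>X. X, farr = \<lambda>f. f\<rparr>"

definition comp_functor ::
  "('o2, 'm2, 'o3, 'm3) fctr \<Rightarrow> ('o1, 'm1, 'o2, 'm2) fctr \<Rightarrow> ('o1, 'm1, 'o3, 'm3) fctr"
  (infixl "\<circ>\<^sub>F" 70) where
  "G \<circ>\<^sub>F F = \<lparr>fobj = fobj G \<circ> fobj F, farr = farr G \<circ> farr F\<rparr>"

definition natural_isomorphism ::
  "('o1, 'm1) cat \<Rightarrow> ('o2, 'm2) cat \<Rightarrow> ('o1, 'm1, 'o2, 'm2) fctr \<Rightarrow>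
   ('o1, 'm1, 'o2, 'm2) fctr \<Rightarrow> ('o1 \<Rightarrow> 'm2) \<Rightarrow> bool" where
  "natural_isomorphism C D F G \<theta> \<longleftrightarrow> is_functor C D F \<and> is_functor C D G \<and>
     (\<forall>X \<in> Obj C. \<theta> X \<in> Hom D (fobj F X) (fobj G X) \<and> is_iso D (\<theta> X)) \<and>
     (\<forall>X \<in> Obj C. \<forall>Y \<in> Obj C. \<forall>f \<in> Hom C X Y.
        \<theta> Y \<cdot>\<^bsub>D\<^esub> farr F f = farr G f \<cdot>\<^bsub>D\<^esub> \<theta> X)"

text \<open>\<open>left_adjoint C D F G\<close>: the functor \<open>F\<close> from \<open>C\<close> to \<open>D\<close> is left adjoint to \<open>G\<close>.\<close>

definition left_adjoint ::
  "('o1, 'm1) cat \<Rightarrow> ('o2, 'm2) cat \<Rightarrow> ('o1, 'm1, 'o2, 'm2) fctr \<Rightarrow>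
   ('o2, 'm2, 'o1, 'm1) fctr \<Rightarrow> bool" where
  "left_adjoint C D F G \<longleftrightarrow> is_functor C D F \<and> is_functor D C G \<and>
     (\<exists>\<Phi>.
       (\<forall>X \<in> Obj C. \<forall>Y \<in> Obj D. bij_betw (\<Phi> X Y) (Hom D (fobj F X) Y) (Hom C X (fobj G Y))) \<and>
       (\<forall>X \<in> Obj C. \<forall>X' \<in> Obj C. \<forall>Y \<in> Obj D. \<forall>Y' \<in> Obj D.
          \<forall>a \<in> Hom C X' X. \<forall>f \<in> Hom D (fobj F X) Y. \<forall>b \<in> Hom D Y Y'.
            \<Phi> X' Y' (b \<cdot>\<^bsub>D\<^esub> f \<cdot>\<^bsub>D\<^esub> farr F a) = farr G b \<cdot>\<^bsub>C\<^esub> \<Phi> X Y f \<cdot>\<^bsub>C\<^esub> a))"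

definition faithful_functor ::
  "('o1, 'm1) cat \<Rightarrow> ('o2, 'm2) cat \<Rightarrow> ('o1, 'm1, 'o2, 'm2) fctr \<Rightarrow> bool" where
  "faithful_functor C D F \<longleftrightarrow> is_functor C D F \<and>
     (\<forall>X \<in> Obj C. \<forall>Y \<in> Obj C. inj_on (farr F) (Hom C X Y))"

definition exact_functor ::
  "('o1, 'm1) cat \<Rightarrow> ('o2, 'm2) cat \<Rightarrow> ('o1, 'm1, 'o2, 'm2) fctr \<Rightarrow> bool" where
  "exact_functor C D F \<longleftrightarrow> is_functor C D F \<and>
     (\<forall>f g. short_exact C f g \<longrightarrow> short_exact D (farr F f) (farr F g))"

definition preserves_coproducts ::
  "'i set set \<Rightarrow> ('o1, 'm1) cat \<Rightarrow> ('o2, 'm2) cat \<Rightarrow> ('o1, 'm1, 'o2, 'm2) fctr \<Rightarrow> bool" where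
  "preserves_coproducts U C D F \<longleftrightarrow>
     (\<forall>I \<in> U. \<forall>X S \<iota>. is_coproduct C I X S \<iota> \<longrightarrow>
        is_coproduct D I (\<lambda>j. fobj F (X j)) (fobj F S) (\<lambda>j. farr F (\<iota> j)))"

definition cleft_extension ::
  "('ob, 'mb) cat \<Rightarrow> ('oa, 'ma) cat \<Rightarrow> ('ob, 'mb, 'oa, 'ma) fctr \<Rightarrow>
   ('oa, 'ma, 'ob, 'mb) fctr \<Rightarrow> ('ob, 'mb, 'oa, 'ma) fctr \<Rightarrow> bool" where
  "cleft_extension B A i e l \<longleftrightarrow>
     abelian_category B \<and> abelian_category A \<and>
     is_functor B A i \<and> is_functor A B e \<and> is_functor B A l \<and>
     faithful_functor A B e \<and> exact_functor A B e \<and>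
     left_adjoint B A l e \<and>
     (\<exists>\<phi>. natural_isomorphism B B (e \<circ>\<^sub>F i) id_functor \<phi>)"

section \<open>Silting objects\<close>

definition D_class :: "('o, 'm) cat \<Rightarrow> 'm \<Rightarrow> 'o set" where
  "D_class C \<sigma> = {L \<in> Obj C. (\<lambda>g. g \<cdot>\<^bsub>C\<^esub> \<sigma>) ` Hom C (Cod C \<sigma>) L = Hom C (Dom C \<sigma>) L}"

definition Gen :: "'i set set \<Rightarrow> ('o, 'm) cat \<Rightarrow> 'o \<Rightarrow> 'o set" where
  "Gen U C X = {Y \<in> Obj C. \<exists>I \<in> U. \<exists>S \<iota> p.
     is_coproduct C I (\<lambda>_. X) S \<iota> \<and> p \<in> Hom C S Y \<and> is_epi C p}"

definition torsion_class :: "'i set set \<Rightarrow> ('o, 'm) cat \<Rightarrow> 'o set \<Rightarrow> bool" where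
  "torsion_class U C T \<longleftrightarrow> T \<subseteq> Obj C \<and>
     (\<forall>p. is_epi C p \<and> Dom C p \<in> T \<longrightarrow> Cod C p \<in> T) \<and>
     (\<forall>f g. short_exact C f g \<and> Dom C f \<in> T \<and> Cod C g \<in> T \<longrightarrow> Cod C f \<in> T) \<and>
     (\<forall>I \<in> U. \<forall>X S \<iota>. is_coproduct C I X S \<iota> \<and> (\<forall>j \<in> I. X j \<in> T) \<longrightarrow> S \<in> T)"

text \<open>\<open>projective_presentation C \<sigma> \<pi> X\<close>: the sequence
  \<open>Dom \<sigma> \<rightarrow> Cod \<sigma> \<rightarrow> X \<rightarrow> 0\<close> with maps \<open>\<sigma>\<close> and \<open>\<pi>\<close> is exact and its first two terms are
  projective.\<close>

definition projective_presentation :: "('o, 'm) cat \<Rightarrow> 'm \<Rightarrow> 'm \<Rightarrow> 'o \<Rightarrow> bool" where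
  "projective_presentation C \<sigma> \<pi> X \<longleftrightarrow> \<sigma> \<in> Arr C \<and> \<pi> \<in> Hom C (Cod C \<sigma>) X \<and>
     projective C (Dom C \<sigma>) \<and> projective C (Cod C \<sigma>) \<and> exact_at C \<sigma> \<pi> \<and> is_epi C \<pi>"

definition partial_silting :: "'i set set \<Rightarrow> ('o, 'm) cat \<Rightarrow> 'o \<Rightarrow> 'm \<Rightarrow> bool" where
  "partial_silting U C X \<sigma> \<longleftrightarrow> (\<exists>\<pi>. projective_presentation C \<sigma> \<pi> X) \<and>
     X \<in> D_class C \<sigma> \<and> torsion_class U C (D_class C \<sigma>)"

definition silting :: "'i set set \<Rightarrow> ('o, 'm) cat \<Rightarrow> 'o \<Rightarrow> 'm \<Rightarrow> bool" where
  "silting U C X \<sigma> \<longleftrightarrow> (\<exists>\<pi>. projective_presentation C \<sigma> \<pi> X) \<and>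
     Gen U C X = D_class C \<sigma>"

end

theory Submission
  imports Defs
begin

text \<open>Combining the adjunction \<open>q \<stileturn> i\<close> with \<open>q l \<cong> Id\<close> yields bijections
  \<open>Hom(P, L) \<cong> Hom(l P, i L)\<close> under which precomposition with \<open>q(\<delta>)\<close> becomes precomposition
  with \<open>\<delta>\<close>.  Hence \<open>L\<close> lies in the class of \<open>q(\<delta>)\<close> iff \<open>i L\<close> lies in the class of \<open>\<delta>\<close>, and
  \<open>q\<close> carries the presentation of \<open>A\<close> to one of \<open>q A\<close>.  The remaining point is that the unit
  \<open>A \<rightarrow> i q A\<close> is an epimorphism.  As \<open>e\<close> is faithful it reflects epimorphisms, so the counit
  \<open>l e A \<rightarrow> A\<close> is epi and \<open>i\<close> preserves epimorphisms; by naturality of the unit it remains to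
  treat the objects \<open>l X\<close>, where the adjunct \<open>X \<rightarrow> e i q l X \<cong> q l X\<close> of the unit is epi by
  the Yoneda lemma.\<close>

section \<open>Categories\<close>

context category
begin

lemma Hom_Dom_Obj: "f \<in> Hom C X Y \<Longrightarrow> X \<in> Obj C"
  using Dom_in_Obj by (auto simp: Hom_def)

lemma Hom_Cod_Obj: "f \<in> Hom C X Y \<Longrightarrow> Y \<in> Obj C"
  using Cod_in_Obj by (auto simp: Hom_def)

lemma Arr_of_Hom: "f \<in> Hom C X Y \<Longrightarrow> f \<in> Arr C"
  by (simp add: Hom_def)

lemma epiD:
  assumes "is_epi C f" "f \<in> Hom C X Y" "g \<in> Hom C Y Z" "h \<in> Hom C Y Z" "g \<cdot> f = h \<cdot> f"
  shows "g = h"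
proof -
  have "Cod C f = Y" using assms(2) by (simp add: Hom_def)
  then show ?thesis using assms Hom_Cod_Obj[OF assms(3)] unfolding is_epi_def by blast
qed

lemma epiI:
  assumes "f \<in> Hom C X Y"
    and "\<And>Z g h. g \<in> Hom C Y Z \<Longrightarrow> h \<in> Hom C Y Z \<Longrightarrow> g \<cdot> f = h \<cdot> f \<Longrightarrow> g = h"
  shows "is_epi C f"
  using assms unfolding is_epi_def Hom_def by blast

lemma epi_comp:
  assumes f: "f \<in> Hom C X Y" "is_epi C f" and g: "g \<in> Hom C Y Z" "is_epi C g"
  shows "is_epi C (g \<cdot> f)"
proof (rule epiI[OF Comp_in_Hom[OF f(1) g(1)]])
  fix W a b assume a: "a \<in> Hom C Z W" and b: "b \<in> Hom C Z W"
    and eq: "a \<cdot> (g \<cdot> f) = b \<cdot> (g \<cdot> f)"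
  have "(a \<cdot> g) \<cdot> f = (b \<cdot> g) \<cdot> f"
    using eq Comp_assoc[OF f(1) g(1) a] Comp_assoc[OF f(1) g(1) b] by simp
  then have "a \<cdot> g = b \<cdot> g"
    using epiD[OF f(2) f(1)] Comp_in_Hom[OF g(1) a] Comp_in_Hom[OF g(1) b] by blast
  then show "a = b" using epiD[OF g(2) g(1) a b] by blast
qed

lemma epi_cancel:
  assumes f: "f \<in> Hom C X Y" and g: "g \<in> Hom C Y Z" and gf: "is_epi C (g \<cdot> f)"
  shows "is_epi C g"
proof (rule epiI[OF g])
  fix W a b assume a: "a \<in> Hom C Z W" and b: "b \<in> Hom C Z W" and "a \<cdot> g = b \<cdot> g"
  then have "a \<cdot> (g \<cdot> f) = b \<cdot> (g \<cdot> f)"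
    using Comp_assoc[OF f g a] Comp_assoc[OF f g b] by simp
  then show "a = b" using epiD[OF gf Comp_in_Hom[OF f g] a b] by blast
qed

text \<open>\<open>inv_arr\<close> is a definite description, so it becomes usable only once
  inverses are known to be unique: two inverses \<open>g\<close> and \<open>h\<close> of
  \<open>f\<close> satisfy \<open>h = (g f) h = g (f h) = g\<close>.\<close>

lemma inv_arr:
  assumes f: "f \<in> Hom C X Y" and "is_iso C f"
  shows "inv_arr C f \<in> Hom C Y X" "inv_arr C f \<cdot> f = Ident C X" "f \<cdot> inv_arr C f = Ident C Y"
proof -
  have XY: "Dom C f = X" "Cod C f = Y" using f by (auto simp: Hom_def)
  obtain g where g: "inverse_arrows C f g" using assms(2) by (auto simp: is_iso_def)
  have "h = g" if h: "inverse_arrows C f h" for h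
  proof -
    have gh: "g \<in> Hom C Y X" "h \<in> Hom C Y X" "g \<cdot> f = Ident C X" "f \<cdot> h = Ident C Y"
      using g h XY by (auto simp: inverse_arrows_def)
    have "h = (g \<cdot> f) \<cdot> h" using gh Ident_left by simp
    also have "\<dots> = g \<cdot> (f \<cdot> h)" using Comp_assoc gh f by blast
    also have "\<dots> = g" using gh Ident_right by simp
    finally show ?thesis .
  qed
  with g have "inverse_arrows C f (inv_arr C f)"
    unfolding inv_arr_def by (rule theI)
  then show "inv_arr C f \<in> Hom C Y X" "inv_arr C f \<cdot> f = Ident C X"
    "f \<cdot> inv_arr C f = Ident C Y"
    using XY by (auto simp: inverse_arrows_def)
qed

lemma Ident_epi: "X \<in> Obj C \<Longrightarrow> is_epi C (Ident C X)"
  by (rule epiI[OF Ident_in_Hom]) (auto simp: Ident_right)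

lemma iso_epi:
  assumes f: "f \<in> Hom C X Y" "is_iso C f"
  shows "is_epi C f"
  using epi_cancel[OF inv_arr(1)[OF f] f(1)] inv_arr(3)[OF f] Ident_epi[OF Hom_Cod_Obj[OF f(1)]]
  by simp

lemma iso_left_cancel:
  assumes f: "f \<in> Hom C X Y" "is_iso C f"
    and a: "a \<in> Hom C W X" and b: "b \<in> Hom C W X" and eq: "f \<cdot> a = f \<cdot> b"
  shows "a = b"
proof -
  note g = inv_arr[OF f]
  have "a = (inv_arr C f \<cdot> f) \<cdot> a" using g Ident_left[OF a] by simp
  also have "\<dots> = (inv_arr C f \<cdot> f) \<cdot> b"
    using Comp_assoc[OF a f(1) g(1)] Comp_assoc[OF b f(1) g(1)] eq by simp
  also have "\<dots> = b" using g Ident_left[OF b] by simp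
  finally show ?thesis .
qed

text \<open>Precomposition with \<open>inv_arr C f\<close> undoes it. Applied to \<phi> and
  \<theta>, this replaces arrows out of \<open>e i Y\<close> and \<open>q l X\<close> by arrows out
  of \<open>Y\<close> and \<open>X\<close>.\<close>

lemma Comp_iso_bij_betw:
  assumes f: "f \<in> Hom C X Y" "is_iso C f"
  shows "bij_betw (\<lambda>g. g \<cdot> f) (Hom C Y Z) (Hom C X Z)"
proof -
  note k = inv_arr[OF f]
  show ?thesis
  proof (rule bij_betw_byWitness[where f' = "\<lambda>g. g \<cdot> inv_arr C f"])
    show "\<forall>g\<in>Hom C Y Z. (g \<cdot> f) \<cdot> inv_arr C f = g"
      using Comp_assoc[OF k(1) f(1)] k(3) Ident_right by auto
    show "\<forall>g\<in>Hom C X Z. (g \<cdot> inv_arr C f) \<cdot> f = g"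
      using Comp_assoc[OF f(1) k(1)] k(2) Ident_right by auto
    show "(\<lambda>g. g \<cdot> f) ` Hom C Y Z \<subseteq> Hom C X Z" using Comp_in_Hom[OF f(1)] by auto
    show "(\<lambda>g. g \<cdot> inv_arr C f) ` Hom C X Z \<subseteq> Hom C Y Z" using Comp_in_Hom[OF k(1)] by auto
  qed
qed

text \<open>Two arrows that agree after \<open>c\<close> solve the same factorisation problem,
  namely that of their common composite with \<open>c\<close>, and such a solution is
  unique.\<close>

lemma cokernel_epi:
  assumes c: "is_cokernel C f c"
  shows "is_epi C c"
proof -
  have f: "f \<in> Hom C (Dom C f) (Cod C f)" and cH: "c \<in> Hom C (Cod C f) (Cod C c)"
    and z: "zero_arrow C (c \<cdot> f)"
    and u: "\<And>W g. W \<in> Obj C \<Longrightarrow> g \<in> Hom C (Cod C f) W \<Longrightarrow> zero_arrow C (g \<cdot> f) \<Longrightarrow>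
      \<exists>!h. h \<in> Hom C (Cod C c) W \<and> h \<cdot> c = g"
    using c unfolding is_cokernel_def by (auto simp: Hom_def)
  show ?thesis
  proof (rule epiI[OF cH])
    fix Z g h assume g: "g \<in> Hom C (Cod C c) Z" and h: "h \<in> Hom C (Cod C c) Z"
      and eq: "g \<cdot> c = h \<cdot> c"
    \<comment> \<open>No addition of arrows is fixed at this stage, so the factorisation of
      \<open>c \<cdot> f\<close> through a zero object is extended by \<open>g\<close>.\<close>
    have "zero_arrow C (g \<cdot> (c \<cdot> f))"
    proof -
      obtain Y a b where Y: "zero_object C Y" and a: "a \<in> Hom C (Dom C f) Y"
        and b: "b \<in> Hom C Y (Cod C c)" and ab: "c \<cdot> f = b \<cdot> a"
        using z Comp_in_Hom[OF f cH] unfolding zero_arrow_def by (auto simp: Hom_def)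
      have "g \<cdot> (c \<cdot> f) = (g \<cdot> b) \<cdot> a" using ab Comp_assoc[OF a b g] by simp
      moreover have "g \<cdot> (c \<cdot> f) \<in> Hom C (Dom C f) Z"
        using Comp_in_Hom[OF Comp_in_Hom[OF f cH] g] .
      ultimately show ?thesis using Y a Comp_in_Hom[OF b g]
        unfolding zero_arrow_def Hom_def by auto
    qed
    then have "zero_arrow C ((g \<cdot> c) \<cdot> f)" using Comp_assoc[OF f cH g] by simp
    from u[OF Hom_Cod_Obj[OF g] Comp_in_Hom[OF cH g] this] show "g = h" using g h eq by auto
  qed
qed

section \<open>Coproducts\<close>

lemma coproduct_injection:
  "is_coproduct C I X S \<iota> \<Longrightarrow> j \<in> I \<Longrightarrow> \<iota> j \<in> Hom C (X j) S"
  by (auto simp: is_coproduct_def)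

lemma coproduct_factor:
  assumes "is_coproduct C I X S \<iota>" "Y \<in> Obj C" "\<And>j. j \<in> I \<Longrightarrow> g j \<in> Hom C (X j) Y"
  obtains h where "h \<in> Hom C S Y" "\<And>j. j \<in> I \<Longrightarrow> h \<cdot> \<iota> j = g j"
  using assms unfolding is_coproduct_def by metis

lemma coproduct_eqI:
  assumes S: "is_coproduct C I X S \<iota>" and a: "a \<in> Hom C S Y" and b: "b \<in> Hom C S Y"
    and eq: "\<And>j. j \<in> I \<Longrightarrow> a \<cdot> \<iota> j = b \<cdot> \<iota> j"
  shows "a = b"
proof -
  have "\<forall>j\<in>I. b \<cdot> \<iota> j \<in> Hom C (X j) Y"
    using Comp_in_Hom[OF coproduct_injection[OF S] b] by blast
  then have "\<exists>!h. h \<in> Hom C S Y \<and> (\<forall>j \<in> I. h \<cdot> \<iota> j = b \<cdot> \<iota> j)"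
    using S Hom_Cod_Obj[OF b] unfolding is_coproduct_def by auto
  then show ?thesis using a b eq by blast
qed

text \<open>Arrows out of \<open>T\<close> can be compared on the injections; along
  \<open>\<iota> j\<close> the map \<open>h\<close> becomes \<open>\<kappa> j \<cdot> p j\<close>,
  and the epimorphism \<open>p j\<close> cancels.\<close>

lemma coproduct_map_epi:
  assumes S: "is_coproduct C I X S \<iota>" and T: "is_coproduct C I Y T \<kappa>"
    and p: "\<And>j. j \<in> I \<Longrightarrow> p j \<in> Hom C (X j) (Y j)" "\<And>j. j \<in> I \<Longrightarrow> is_epi C (p j)"
    and h: "h \<in> Hom C S T" "\<And>j. j \<in> I \<Longrightarrow> h \<cdot> \<iota> j = \<kappa> j \<cdot> p j"
  shows "is_epi C h"
proof (rule epiI[OF h(1)])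
  fix Z a b assume a: "a \<in> Hom C T Z" and b: "b \<in> Hom C T Z" and eq: "a \<cdot> h = b \<cdot> h"
  show "a = b"
  proof (rule coproduct_eqI[OF T a b])
    fix j assume j: "j \<in> I"
    note \<iota> = coproduct_injection[OF S j] and \<kappa> = coproduct_injection[OF T j]
    have *: "(c \<cdot> \<kappa> j) \<cdot> p j = (c \<cdot> h) \<cdot> \<iota> j" if "c \<in> Hom C T Z" for c
      using Comp_assoc[OF p(1)[OF j] \<kappa> that] Comp_assoc[OF \<iota> h(1) that] h(2)[OF j] by simp
    have "(a \<cdot> \<kappa> j) \<cdot> p j = (b \<cdot> \<kappa> j) \<cdot> p j" using *[OF a] *[OF b] eq by simp
    then show "a \<cdot> \<kappa> j = b \<cdot> \<kappa> j"
      using epiD[OF p(2)[OF j] p(1)[OF j] Comp_in_Hom[OF \<kappa> a] Comp_in_Hom[OF \<kappa> b]] by blast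
  qed
qed

lemma D_classD:
  assumes "L \<in> D_class C \<sigma>" "\<sigma> \<in> Hom C X Y" "f \<in> Hom C X L"
  obtains g where "g \<in> Hom C Y L" "g \<cdot> \<sigma> = f"
proof -
  have "f \<in> (\<lambda>g. g \<cdot> \<sigma>) ` Hom C Y L"
    using assms unfolding D_class_def by (auto simp: Hom_def)
  then show ?thesis using that by auto
qed

text \<open>Only one inclusion of the image equality in \<open>D_class\<close> has to be checked,
  since composites with \<sigma> always lie in the target Hom set.\<close>

lemma D_classI:
  assumes L: "L \<in> Obj C" and \<sigma>: "\<sigma> \<in> Hom C X Y"
    and ex: "\<And>f. f \<in> Hom C X L \<Longrightarrow> \<exists>g\<in>Hom C Y L. g \<cdot> \<sigma> = f"
  shows "L \<in> D_class C \<sigma>"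
proof -
  have "(\<lambda>g. g \<cdot> \<sigma>) ` Hom C Y L = Hom C X L"
    using ex Comp_in_Hom[OF \<sigma>] by auto
  then show ?thesis using L \<sigma> by (auto simp: D_class_def Hom_def)
qed

end

section \<open>Zero arrows and exactness\<close>

text \<open>The record of a category carries no addition, so a chosen enrichment enters as two
  further parameters.\<close>

locale preadditive_category = category C for C :: "('o, 'm) cat" (structure) +
  fixes add :: "'m \<Rightarrow> 'm \<Rightarrow> 'm" and zero :: "'o \<Rightarrow> 'o \<Rightarrow> 'm"
  assumes preadditive: "preadditive C add zero"
    and zero_object: "\<exists>Z. zero_object C Z"
begin

abbreviation HomG :: "'o \<Rightarrow> 'o \<Rightarrow> 'm monoid" where
  "HomG X Y \<equiv> \<lparr>carrier = Hom C X Y, mult = add, one = zero X Y\<rparr>"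

lemma HomG: "X \<in> Obj C \<Longrightarrow> Y \<in> Obj C \<Longrightarrow> comm_group (HomG X Y)"
  using preadditive by (auto simp: preadditive_def)

lemma add_in_Hom: "f \<in> Hom C X Y \<Longrightarrow> g \<in> Hom C X Y \<Longrightarrow> add f g \<in> Hom C X Y"
proof -
  assume fg: "f \<in> Hom C X Y" "g \<in> Hom C X Y"
  interpret H: comm_group "HomG X Y" using HomG[OF Hom_Dom_Obj Hom_Cod_Obj] fg by blast
  show ?thesis using H.m_closed[of f g] fg by simp
qed

lemma zero_in_Hom: "X \<in> Obj C \<Longrightarrow> Y \<in> Obj C \<Longrightarrow> zero X Y \<in> Hom C X Y"
proof -
  assume "X \<in> Obj C" "Y \<in> Obj C"
  then interpret H: comm_group "HomG X Y" by (rule HomG)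
  show ?thesis using H.one_closed by simp
qed

lemma distrib_left:
  "f \<in> Hom C X Y \<Longrightarrow> f' \<in> Hom C X Y \<Longrightarrow> g \<in> Hom C Y Z \<Longrightarrow> g \<cdot> add f f' = add (g \<cdot> f) (g \<cdot> f')"
  using preadditive Hom_Dom_Obj Hom_Cod_Obj unfolding preadditive_def by blast

lemma distrib_right:
  "f \<in> Hom C X Y \<Longrightarrow> g \<in> Hom C Y Z \<Longrightarrow> g' \<in> Hom C Y Z \<Longrightarrow> add g g' \<cdot> f = add (g \<cdot> f) (g' \<cdot> f)"
  using preadditive Hom_Dom_Obj Hom_Cod_Obj unfolding preadditive_def by blast

text \<open>Cancellation in the Hom group. By distributivity a composite with \<open>zero\<close> is
  such an idempotent, and this yields both composition laws for \<open>zero\<close>.\<close>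

lemma add_idem_zero:
  assumes "f \<in> Hom C X Y" "add f f = f"
  shows "f = zero X Y"
proof -
  interpret H: comm_group "HomG X Y"
    using HomG[OF Hom_Dom_Obj Hom_Cod_Obj] assms(1) by blast
  show ?thesis using H.l_cancel_one[of f f] assms by simp
qed

lemma add_zero: "f \<in> Hom C X Y \<Longrightarrow> add f (zero X Y) = f"
proof -
  assume f: "f \<in> Hom C X Y"
  interpret H: comm_group "HomG X Y" using HomG[OF Hom_Dom_Obj Hom_Cod_Obj] f by blast
  show ?thesis using H.r_one[of f] f by simp
qed

lemma zero_Comp:
  assumes f: "f \<in> Hom C X Y" and Z: "Z \<in> Obj C"
  shows "zero Y Z \<cdot> f = zero X Z"
proof -
  have z: "zero Y Z \<in> Hom C Y Z" using zero_in_Hom Hom_Cod_Obj[OF f] Z by blast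
  have "add (zero Y Z \<cdot> f) (zero Y Z \<cdot> f) = zero Y Z \<cdot> f"
    using distrib_right[OF f z z] add_zero[OF z] by simp
  then show ?thesis using add_idem_zero Comp_in_Hom[OF f z] by blast
qed

lemma Comp_zero:
  assumes g: "g \<in> Hom C Y Z" and X: "X \<in> Obj C"
  shows "g \<cdot> zero X Y = zero X Z"
proof -
  have z: "zero X Y \<in> Hom C X Y" using zero_in_Hom Hom_Dom_Obj[OF g] X by blast
  have "add (g \<cdot> zero X Y) (g \<cdot> zero X Y) = g \<cdot> zero X Y"
    using distrib_left[OF z z g] add_zero[OF z] by simp
  then show ?thesis using add_idem_zero Comp_in_Hom[OF z g] by blast
qed

text \<open>This reconciles the two notions of zero: an arrow out of a zero object is unique and
  hence the neutral element, and conversely the neutral element factors through any zero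
  object.\<close>

lemma zero_arrow_iff:
  assumes f: "f \<in> Hom C X Y"
  shows "zero_arrow C f \<longleftrightarrow> f = zero X Y"
proof
  note XY = Hom_Dom_Obj[OF f] Hom_Cod_Obj[OF f]
  assume "zero_arrow C f"
  then obtain Z g h where Z: "zero_object C Z" and g: "g \<in> Hom C X Z" and h: "h \<in> Hom C Z Y"
    and fe: "f = h \<cdot> g"
    using f unfolding zero_arrow_def by (auto simp: Hom_def)
  have "h = zero Z Y" using Z h XY zero_in_Hom[of Z Y] unfolding zero_object_def by auto
  then show "f = zero X Y" using fe zero_Comp[OF g XY(2)] by simp
next
  note XY = Hom_Dom_Obj[OF f] Hom_Cod_Obj[OF f]
  obtain Z where Z: "zero_object C Z" using zero_object by blast
  then have ZO: "Z \<in> Obj C" by (simp add: zero_object_def)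
  assume "f = zero X Y"
  then have "f = zero Z Y \<cdot> zero X Z"
    using zero_Comp[OF zero_in_Hom[OF XY(1) ZO] XY(2)] by simp
  then show "zero_arrow C f"
    using f Z zero_in_Hom[OF XY(1) ZO] zero_in_Hom[OF ZO XY(2)]
    unfolding zero_arrow_def Hom_def by auto
qed

lemma zero_arrow_Comp_right:
  assumes "zero_arrow C g" and f: "f \<in> Hom C X Y" and g: "g \<in> Hom C Y Z"
  shows "zero_arrow C (g \<cdot> f)"
  using assms zero_arrow_iff[OF g] zero_arrow_iff[OF Comp_in_Hom[OF f g]]
    zero_Comp[OF f Hom_Cod_Obj[OF g]] by simp

lemma zero_arrow_Comp_left:
  assumes "zero_arrow C f" and f: "f \<in> Hom C X Y" and g: "g \<in> Hom C Y Z"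
  shows "zero_arrow C (g \<cdot> f)"
  using assms zero_arrow_iff[OF f] zero_arrow_iff[OF Comp_in_Hom[OF f g]]
    Comp_zero[OF g Hom_Dom_Obj[OF f]] by simp

text \<open>Zero arrows are exactly the (co)constant arrows; unlike the factorisation through a zero
  object, these conditions pass through an adjunction directly.\<close>

lemma zero_arrow_iff_coconstant:
  assumes f: "f \<in> Hom C X Y"
  shows "zero_arrow C f \<longleftrightarrow> (\<forall>W. \<forall>g\<in>Hom C Y W. \<forall>h\<in>Hom C Y W. g \<cdot> f = h \<cdot> f)"
proof
  assume "zero_arrow C f"
  then show "\<forall>W. \<forall>g\<in>Hom C Y W. \<forall>h\<in>Hom C Y W. g \<cdot> f = h \<cdot> f"
    using zero_arrow_iff[OF f] Comp_zero Hom_Dom_Obj[OF f] by auto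
next
  assume "\<forall>W. \<forall>g\<in>Hom C Y W. \<forall>h\<in>Hom C Y W. g \<cdot> f = h \<cdot> f"
  then have "Ident C Y \<cdot> f = zero Y Y \<cdot> f"
    using Ident_in_Hom zero_in_Hom Hom_Cod_Obj[OF f] by blast
  then show "zero_arrow C f"
    using zero_arrow_iff[OF f] Ident_left[OF f] zero_Comp[OF f Hom_Cod_Obj[OF f]] by simp
qed

lemma zero_arrow_iff_constant:
  assumes f: "f \<in> Hom C X Y"
  shows "zero_arrow C f \<longleftrightarrow> (\<forall>W. \<forall>g\<in>Hom C W X. \<forall>h\<in>Hom C W X. f \<cdot> g = f \<cdot> h)"
proof
  assume "zero_arrow C f"
  then show "\<forall>W. \<forall>g\<in>Hom C W X. \<forall>h\<in>Hom C W X. f \<cdot> g = f \<cdot> h"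
    using zero_arrow_iff[OF f] zero_Comp Hom_Cod_Obj[OF f] by auto
next
  assume "\<forall>W. \<forall>g\<in>Hom C W X. \<forall>h\<in>Hom C W X. f \<cdot> g = f \<cdot> h"
  then have "f \<cdot> Ident C X = f \<cdot> zero X X"
    using Ident_in_Hom zero_in_Hom Hom_Dom_Obj[OF f] by blast
  then show "zero_arrow C f"
    using zero_arrow_iff[OF f] Ident_right[OF f] Comp_zero[OF f Hom_Dom_Obj[OF f]] by simp
qed

text \<open>Subtraction, with \<open>d\<close> equal to \<open>a - b\<close>, given by its defining
  equation so that later arguments need only \<open>add\<close>.\<close>

lemma difference_exists:
  assumes a: "a \<in> Hom C X Y" and b: "b \<in> Hom C X Y"
  obtains d where "d \<in> Hom C X Y" "add b d = a"
proof -
  interpret H: comm_group "HomG X Y"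
    using HomG[OF Hom_Dom_Obj Hom_Cod_Obj] a by blast
  let ?d = "inv\<^bsub>HomG X Y\<^esub> b \<otimes>\<^bsub>HomG X Y\<^esub> a"
  have "?d \<in> carrier (HomG X Y)" using a b by (intro H.m_closed H.inv_closed) auto
  moreover have "b \<otimes>\<^bsub>HomG X Y\<^esub> ?d = a"
    using a b H.inv_closed[of b] H.m_assoc[of b "inv\<^bsub>HomG X Y\<^esub> b" a] H.r_inv[of b] H.l_one[of a]
    by simp
  ultimately show ?thesis using that by simp
qed

lemma add_eq_left_zero:
  assumes "a \<in> Hom C X Y" "b \<in> Hom C X Y" "add a b = a"
  shows "b = zero X Y"
proof -
  interpret H: comm_group "HomG X Y"
    using HomG[OF Hom_Dom_Obj Hom_Cod_Obj] assms(1) by blast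
  show ?thesis using H.l_cancel_one[of a b] assms by simp
qed

end

section \<open>Cokernels, short exact sequences and extensions in abelian categories\<close>

locale abelian_cat = preadditive_category +
  assumes abelian: "abelian_category C"
begin

text \<open>An epimorphism \<open>g\<close> is the cokernel of some \<open>h\<close>. If
  \<open>x\<close> kills \<open>f\<close>, it factors through the cokernel \<open>c\<close> of
  \<open>f\<close> and so kills the common kernel \<open>k\<close> of \<open>c\<close> and
  \<open>g\<close>. As \<open>h\<close> factors through \<open>k\<close>, \<open>x\<close> also
  kills \<open>h\<close> and therefore factors through \<open>g\<close>.\<close>

lemma exact_epi_cokernel:
  assumes ex: "exact_at C f g" and epi: "is_epi C g"
  shows "is_cokernel C f g"
proof -
  obtain c k where c: "is_cokernel C f c" and k: "is_kernel C c k" and gk: "is_kernel C g k"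
    using ex by (auto simp: exact_at_def)
  obtain h where h: "is_cokernel C h g" using abelian epi by (auto simp: abelian_category_def)
  define X Y Z V K H where "X = Dom C f" and "Y = Cod C f" and "Z = Cod C g" and "V = Cod C c"
    and "K = Dom C k" and "H = Dom C h"
  have f: "f \<in> Hom C X Y" and cH: "c \<in> Hom C Y V" and kH: "k \<in> Hom C K Y"
    and gH: "g \<in> Hom C Y Z" and hH: "h \<in> Hom C H Y"
    using c k gk h unfolding is_cokernel_def is_kernel_def X_def Y_def Z_def V_def K_def H_def
    by (auto simp: Hom_def)
  have doms: "Dom C f = X" "Cod C f = Y" "Dom C c = Y" "Cod C c = V" "Dom C k = K" "Cod C k = Y"
    "Dom C g = Y" "Cod C g = Z" "Dom C h = H" "Cod C h = Y"
    using f cH kH gH hH by (auto simp: Hom_def)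
  have ck0: "zero_arrow C (c \<cdot> k)" and gk0: "zero_arrow C (g \<cdot> k)"
    and gh0: "zero_arrow C (g \<cdot> h)" and cf0: "zero_arrow C (c \<cdot> f)"
    using c k gk h by (auto simp: is_cokernel_def is_kernel_def)
  have gu: "\<exists>u. u \<in> Hom C Z W \<and> u \<cdot> g = x"
    if "x \<in> Hom C Y W" "zero_arrow C (x \<cdot> h)" for W x
    using h that Hom_Cod_Obj unfolding is_cokernel_def doms by blast
  have "zero_arrow C (g \<cdot> f)"
  proof -
    obtain s where s: "s \<in> Hom C X K" "k \<cdot> s = f"
      using k f cf0 Hom_Dom_Obj[OF f] unfolding is_kernel_def doms by metis
    then show ?thesis
      using zero_arrow_Comp_right[OF gk0 s(1) Comp_in_Hom[OF kH gH]] Comp_assoc[OF s(1) kH gH]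
      by simp
  qed
  moreover have "\<exists>!u. u \<in> Hom C Z W \<and> u \<cdot> g = x"
    if x: "x \<in> Hom C Y W" and xf: "zero_arrow C (x \<cdot> f)" for W x
  proof -
    obtain y where y: "y \<in> Hom C V W" "y \<cdot> c = x"
      using c x xf Hom_Cod_Obj[OF x] unfolding is_cokernel_def doms by metis
    obtain t where t: "t \<in> Hom C H K" "k \<cdot> t = h"
      using gk hH gh0 Hom_Dom_Obj[OF hH] unfolding is_kernel_def doms by metis
    have "zero_arrow C (y \<cdot> (c \<cdot> k))"
      using zero_arrow_Comp_left[OF ck0 Comp_in_Hom[OF kH cH] y(1)] .
    then have "zero_arrow C (x \<cdot> k)" using Comp_assoc[OF kH cH y(1)] y(2) by simp
    then have "zero_arrow C (x \<cdot> h)"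
      using zero_arrow_Comp_right[OF _ t(1) Comp_in_Hom[OF kH x]] Comp_assoc[OF t(1) kH x] t(2)
      by simp
    with gu x have "\<exists>u. u \<in> Hom C Z W \<and> u \<cdot> g = x" by blast
    then show ?thesis using epiD[OF epi gH] by blast
  qed
  ultimately show ?thesis
    using f gH c unfolding is_cokernel_def doms by (blast intro: Arr_of_Hom)
qed

text \<open>In \<open>exact_at\<close> the arrow \<open>g\<close> itself serves as the cokernel of
  \<open>f\<close>, so any kernel of \<open>g\<close> has both required properties.\<close>

lemma cokernel_exact:
  assumes "is_cokernel C f g"
  shows "exact_at C f g"
proof -
  have "g \<in> Arr C" using assms by (simp add: is_cokernel_def)
  then obtain k where "is_kernel C g k" using abelian by (auto simp: abelian_category_def)
  with assms show ?thesis by (auto simp: exact_at_def)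
qed

text \<open>The monomorphism \<open>f\<close> is a kernel of some \<open>h\<close>. Since
  \<open>h\<close> kills \<open>f\<close>, it factors through the cokernel \<open>c\<close> and
  kills its kernel \<open>k\<close>. An arrow killed by \<open>g\<close> factors through
  \<open>k\<close>, hence is killed by \<open>h\<close> and lifts through \<open>f\<close>.\<close>

lemma short_exact_factor:
  assumes se: "short_exact C f g" and f: "f \<in> Hom C X Y" and g: "g \<in> Hom C Y Z"
    and x: "x \<in> Hom C W Y" and gx: "zero_arrow C (g \<cdot> x)"
  obtains d where "d \<in> Hom C W X" "f \<cdot> d = x"
proof -
  obtain c k where c: "is_cokernel C f c" and k: "is_kernel C c k" and gk: "is_kernel C g k"
    using se by (auto simp: exact_at_def short_exact_def)
  obtain h where h: "is_kernel C h f"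
    using abelian se by (auto simp: abelian_category_def short_exact_def)
  define V K H where "V = Cod C c" and "K = Dom C k" and "H = Cod C h"
  have cH: "c \<in> Hom C Y V" and kH: "k \<in> Hom C K Y" and hH: "h \<in> Hom C Y H"
    using c k gk h f g unfolding is_cokernel_def is_kernel_def V_def K_def H_def
    by (auto simp: Hom_def)
  have doms: "Dom C f = X" "Cod C f = Y" "Dom C c = Y" "Cod C c = V" "Dom C k = K" "Cod C k = Y"
    "Dom C g = Y" "Cod C g = Z" "Dom C h = Y" "Cod C h = H"
    using f cH kH g hH by (auto simp: Hom_def)
  have ck0: "zero_arrow C (c \<cdot> k)" and hf0: "zero_arrow C (h \<cdot> f)"
    using k h by (auto simp: is_kernel_def)
  obtain y where y: "y \<in> Hom C V H" "y \<cdot> c = h"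
    using c hH hf0 Hom_Cod_Obj[OF hH] unfolding is_cokernel_def doms by metis
  obtain t where t: "t \<in> Hom C W K" "k \<cdot> t = x"
    using gk x gx Hom_Dom_Obj[OF x] unfolding is_kernel_def doms by metis
  have "zero_arrow C (y \<cdot> (c \<cdot> k))"
    using zero_arrow_Comp_left[OF ck0 Comp_in_Hom[OF kH cH] y(1)] .
  then have "zero_arrow C (h \<cdot> k)" using Comp_assoc[OF kH cH y(1)] y(2) by simp
  then have "zero_arrow C (h \<cdot> x)"
    using zero_arrow_Comp_right[OF _ t(1) Comp_in_Hom[OF kH hH]] Comp_assoc[OF t(1) kH hH] t(2)
    by simp
  then obtain d where "d \<in> Hom C W X" "f \<cdot> d = x"
    using h x Hom_Dom_Obj[OF x] unfolding is_kernel_def doms by metis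
  then show ?thesis using that by blast
qed

text \<open>An extension along \<sigma> is found first modulo \<open>X\<close>: the arrow into
  \<open>Z\<close> extends to \<open>Q\<close> and lifts to \<open>Y\<close> by projectivity of
  \<open>Q\<close>. The remaining error takes values in \<open>X\<close>, where it extends as well,
  and the two extensions are added.\<close>

lemma D_class_extension:
  assumes \<sigma>: "\<sigma> \<in> Hom C P Q" and Q: "projective C Q"
    and se: "short_exact C f g" and fX: "Dom C f \<in> D_class C \<sigma>" and gZ: "Cod C g \<in> D_class C \<sigma>"
  shows "Cod C f \<in> D_class C \<sigma>"
proof -
  define X Y Z where "X = Dom C f" and "Y = Cod C f" and "Z = Cod C g"
  have "f \<in> Arr C" "g \<in> Arr C" "Dom C g = Cod C f"
    using se unfolding short_exact_def is_mono_def is_epi_def exact_at_def is_kernel_def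
      is_cokernel_def by auto
  then have f: "f \<in> Hom C X Y" and g: "g \<in> Hom C Y Z"
    by (auto simp: X_def Y_def Z_def Hom_def)
  note X = fX[folded X_def] and Z = gZ[folded Z_def]
  note P = Hom_Dom_Obj[OF \<sigma>]
  have "\<exists>b\<in>Hom C Q Y. b \<cdot> \<sigma> = a" if a: "a \<in> Hom C P Y" for a
  proof -
    obtain b where b: "b \<in> Hom C Q Z" "b \<cdot> \<sigma> = g \<cdot> a"
      using D_classD[OF Z \<sigma> Comp_in_Hom[OF a g]] .
    obtain c where c: "c \<in> Hom C Q Y" "g \<cdot> c = b"
    proof -
      have "Dom C g = Y" "Cod C g = Z" using g by (auto simp: Hom_def)
      then show ?thesis
        using Q se b(1) that unfolding projective_def short_exact_def by blast
    qed
    have c\<sigma>: "c \<cdot> \<sigma> \<in> Hom C P Y" using Comp_in_Hom[OF \<sigma> c(1)] .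
    obtain d where d: "d \<in> Hom C P Y" "add (c \<cdot> \<sigma>) d = a" using difference_exists[OF a c\<sigma>] .
    \<comment> \<open>\<open>a\<close> and \<open>c \<cdot> \<sigma>\<close> have the same composite
      with \<open>g\<close>, so the error \<open>d\<close> is killed by \<open>g\<close>.\<close>
    have "add (g \<cdot> a) (g \<cdot> d) = g \<cdot> a"
      using distrib_left[OF c\<sigma> d(1) g] d(2) Comp_assoc[OF \<sigma> c(1) g] c(2) b(2) by simp
    then have "zero_arrow C (g \<cdot> d)"
      using add_eq_left_zero Comp_in_Hom[OF a g] Comp_in_Hom[OF d(1) g] zero_arrow_iff by metis
    then obtain x where x: "x \<in> Hom C P X" "f \<cdot> x = d"
      using short_exact_factor[OF se f g d(1)] by blast
    obtain y where y: "y \<in> Hom C Q X" "y \<cdot> \<sigma> = x" using D_classD[OF X \<sigma> x(1)] .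
    have fy: "f \<cdot> y \<in> Hom C Q Y" using Comp_in_Hom[OF y(1) f] .
    have "add c (f \<cdot> y) \<cdot> \<sigma> = a"
      using distrib_right[OF \<sigma> c(1) fy] Comp_assoc[OF \<sigma> y(1) f] y x d by simp
    then show ?thesis using add_in_Hom[OF c(1) fy] by blast
  qed
  then show ?thesis using D_classI[OF Hom_Cod_Obj[OF f] \<sigma>] by (simp add: Y_def)
qed

end

text \<open>Makes a choice of enrichment, so that the locale can be entered from the purely
  existential \<open>abelian_category\<close>.\<close>

lemma abelian_catI:
  fixes C :: "('o, 'm) cat"
  assumes "abelian_category C"
  obtains add zero where "abelian_cat C add zero"
proof -
  obtain add zero where "preadditive C add zero"
    using assms by (auto simp: abelian_category_def)
  then have "abelian_cat C add zero"
    using assms unfolding abelian_cat_def abelian_cat_axioms_def preadditive_category_def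
      preadditive_category_axioms_def abelian_category_def by blast
  then show ?thesis using that by blast
qed

lemma GenI:
  assumes "Y \<in> Obj C" "I \<in> U" "is_coproduct C I (\<lambda>_. X) S \<iota>" "p \<in> Hom C S Y" "is_epi C p"
  shows "Y \<in> Gen U C X"
  using assms by (auto simp: Gen_def)

section \<open>Functors and adjunctions\<close>

lemma functor_Obj: "is_functor C D F \<Longrightarrow> X \<in> Obj C \<Longrightarrow> fobj F X \<in> Obj D"
  by (auto simp: is_functor_def)

lemma functor_Hom:
  "is_functor C D F \<Longrightarrow> f \<in> Hom C X Y \<Longrightarrow> farr F f \<in> Hom D (fobj F X) (fobj F Y)"
  using category.Hom_Dom_Obj category.Hom_Cod_Obj unfolding is_functor_def by metis

lemma functor_Ident: "is_functor C D F \<Longrightarrow> X \<in> Obj C \<Longrightarrow> farr F (Ident C X) = Ident D (fobj F X)"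
  by (auto simp: is_functor_def)

lemma functor_Comp:
  "is_functor C D F \<Longrightarrow> f \<in> Hom C X Y \<Longrightarrow> g \<in> Hom C Y Z \<Longrightarrow>
    farr F (g \<cdot>\<^bsub>C\<^esub> f) = farr F g \<cdot>\<^bsub>D\<^esub> farr F f"
  using category.Hom_Dom_Obj category.Hom_Cod_Obj unfolding is_functor_def by metis

text \<open>The equation is mapped by \<open>F\<close>, cancelled in \<open>D\<close> and pulled
  back by injectivity on Hom sets. It is applied to both \<open>e\<close> and
  \<open>i\<close>.\<close>

lemma faithful_reflects_epi:
  assumes F: "faithful_functor C D F" and f: "f \<in> Hom C X Y" and epi: "is_epi D (farr F f)"
  shows "is_epi C f"
proof -
  have FF: "is_functor C D F" using F by (simp add: faithful_functor_def)
  interpret C: category C using FF by (simp add: is_functor_def)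
  interpret D: category D using FF by (simp add: is_functor_def)
  show ?thesis
  proof (rule C.epiI[OF f])
    fix Z g h assume g: "g \<in> Hom C Y Z" and h: "h \<in> Hom C Y Z" and "g \<cdot>\<^bsub>C\<^esub> f = h \<cdot>\<^bsub>C\<^esub> f"
    then have "farr F g \<cdot>\<^bsub>D\<^esub> farr F f = farr F h \<cdot>\<^bsub>D\<^esub> farr F f"
      using functor_Comp[OF FF f] by metis
    then have "farr F g = farr F h"
      using D.epiD[OF epi functor_Hom[OF FF f]] functor_Hom[OF FF g] functor_Hom[OF FF h] by blast
    then show "g = h"
      using F g h C.Hom_Dom_Obj[OF g] C.Hom_Cod_Obj[OF g]
      unfolding faithful_functor_def by (auto dest: inj_onD)
  qed
qed

section \<open>Adjunctions given by hom bijections\<close>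

locale adjunction =
  fixes C :: "('o1, 'm1) cat" and D :: "('o2, 'm2) cat"
    and F :: "('o1, 'm1, 'o2, 'm2) fctr" and G :: "('o2, 'm2, 'o1, 'm1) fctr"
    and \<Phi> :: "'o1 \<Rightarrow> 'o2 \<Rightarrow> 'm2 \<Rightarrow> 'm1"
  assumes F: "is_functor C D F" and G: "is_functor D C G"
    and bij: "X \<in> Obj C \<Longrightarrow> Y \<in> Obj D \<Longrightarrow>
      bij_betw (\<Phi> X Y) (Hom D (fobj F X) Y) (Hom C X (fobj G Y))"
    and natural: "a \<in> Hom C X' X \<Longrightarrow> f \<in> Hom D (fobj F X) Y \<Longrightarrow> b \<in> Hom D Y Y' \<Longrightarrow>
      \<Phi> X' Y' (b \<cdot>\<^bsub>D\<^esub> f \<cdot>\<^bsub>D\<^esub> farr F a) = farr G b \<cdot>\<^bsub>C\<^esub> \<Phi> X Y f \<cdot>\<^bsub>C\<^esub> a"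
begin

sublocale C: category C using F by (simp add: is_functor_def)
sublocale D: category D using F by (simp add: is_functor_def)

lemma adjunct_Hom:
  assumes "X \<in> Obj C" and f: "f \<in> Hom D (fobj F X) Y"
  shows "\<Phi> X Y f \<in> Hom C X (fobj G Y)"
  using bij_betw_apply[OF bij[OF assms(1) D.Hom_Cod_Obj[OF f]]] f by blast

lemma adjunct_inject:
  assumes "X \<in> Obj C" and f: "f \<in> Hom D (fobj F X) Y" and "g \<in> Hom D (fobj F X) Y"
    and "\<Phi> X Y f = \<Phi> X Y g"
  shows "f = g"
  using bij[OF assms(1) D.Hom_Cod_Obj[OF f]] assms by (auto simp: bij_betw_def dest: inj_onD)

lemma adjunct_surject:
  assumes "Y \<in> Obj D" and g: "g \<in> Hom C X (fobj G Y)"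
  obtains f where "f \<in> Hom D (fobj F X) Y" "\<Phi> X Y f = g"
proof -
  have "g \<in> \<Phi> X Y ` Hom D (fobj F X) Y"
    using bij[OF C.Hom_Dom_Obj[OF g] assms(1)] g by (auto simp: bij_betw_def)
  then show ?thesis using that by blast
qed

lemma natural_right:
  assumes X: "X \<in> Obj C" and f: "f \<in> Hom D (fobj F X) Y" and b: "b \<in> Hom D Y Y'"
  shows "\<Phi> X Y' (b \<cdot>\<^bsub>D\<^esub> f) = farr G b \<cdot>\<^bsub>C\<^esub> \<Phi> X Y f"
proof -
  have "\<Phi> X Y' (b \<cdot>\<^bsub>D\<^esub> f \<cdot>\<^bsub>D\<^esub> farr F (Ident C X)) = farr G b \<cdot>\<^bsub>C\<^esub> \<Phi> X Y f \<cdot>\<^bsub>C\<^esub> Ident C X"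
    using natural[OF C.Ident_in_Hom[OF X] f b] .
  moreover have "b \<cdot>\<^bsub>D\<^esub> f \<cdot>\<^bsub>D\<^esub> farr F (Ident C X) = b \<cdot>\<^bsub>D\<^esub> f"
    using functor_Ident[OF F X] D.Ident_right[OF D.Comp_in_Hom[OF f b]] by simp
  moreover have "farr G b \<cdot>\<^bsub>C\<^esub> \<Phi> X Y f \<cdot>\<^bsub>C\<^esub> Ident C X = farr G b \<cdot>\<^bsub>C\<^esub> \<Phi> X Y f"
    using C.Ident_right[OF C.Comp_in_Hom[OF adjunct_Hom[OF X f] functor_Hom[OF G b]]] .
  ultimately show ?thesis by simp
qed

lemma natural_left:
  assumes a: "a \<in> Hom C X' X" and f: "f \<in> Hom D (fobj F X) Y"
  shows "\<Phi> X' Y (f \<cdot>\<^bsub>D\<^esub> farr F a) = \<Phi> X Y f \<cdot>\<^bsub>C\<^esub> a"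
proof -
  note Y = D.Hom_Cod_Obj[OF f]
  have "\<Phi> X' Y (Ident D Y \<cdot>\<^bsub>D\<^esub> f \<cdot>\<^bsub>D\<^esub> farr F a) = farr G (Ident D Y) \<cdot>\<^bsub>C\<^esub> \<Phi> X Y f \<cdot>\<^bsub>C\<^esub> a"
    using natural[OF a f D.Ident_in_Hom[OF Y]] .
  then show ?thesis
    using functor_Ident[OF G Y] D.Ident_left[OF f]
      C.Ident_left[OF adjunct_Hom[OF C.Hom_Cod_Obj[OF a] f]] by simp
qed

definition unit :: "'o1 \<Rightarrow> 'm1" where
  "unit X = \<Phi> X (fobj F X) (Ident D (fobj F X))"

lemma unit_Hom: "X \<in> Obj C \<Longrightarrow> unit X \<in> Hom C X (fobj G (fobj F X))"
  unfolding unit_def using adjunct_Hom[OF _ D.Ident_in_Hom[OF functor_Obj[OF F]]] by blast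

text \<open>The Yoneda argument: naturality applied to \<open>f\<close> after the identity shows
  that the bijection is determined by the image of the identity.\<close>

lemma adjunct_eq_unit:
  assumes X: "X \<in> Obj C" and f: "f \<in> Hom D (fobj F X) Y"
  shows "\<Phi> X Y f = farr G f \<cdot>\<^bsub>C\<^esub> unit X"
  using natural_right[OF X D.Ident_in_Hom[OF functor_Obj[OF F X]] f] D.Ident_right[OF f]
  by (simp add: unit_def)

lemma adjunct_farr:
  assumes a: "a \<in> Hom C X' X"
  shows "\<Phi> X' (fobj F X) (farr F a) = unit X \<cdot>\<^bsub>C\<^esub> a"
  using natural_left[OF a D.Ident_in_Hom[OF functor_Obj[OF F C.Hom_Cod_Obj[OF a]]]]
    D.Ident_left[OF functor_Hom[OF F a]] by (simp add: unit_def)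

text \<open>Both sides are the adjunct of \<open>farr F a\<close>.\<close>

lemma unit_natural:
  assumes a: "a \<in> Hom C X' X"
  shows "farr G (farr F a) \<cdot>\<^bsub>C\<^esub> unit X' = unit X \<cdot>\<^bsub>C\<^esub> a"
  using adjunct_farr[OF a] adjunct_eq_unit[OF C.Hom_Dom_Obj[OF a] functor_Hom[OF F a]] by simp

text \<open>Under \<Phi>, precomposition with \<open>farr F a\<close> becomes precomposition with
  \<open>a\<close>, which is injective.\<close>

lemma left_adjoint_epi:
  assumes a: "a \<in> Hom C X' X" and epi: "is_epi C a"
  shows "is_epi D (farr F a)"
proof (rule D.epiI[OF functor_Hom[OF F a]])
  fix Z g h assume g: "g \<in> Hom D (fobj F X) Z" and h: "h \<in> Hom D (fobj F X) Z"
    and "g \<cdot>\<^bsub>D\<^esub> farr F a = h \<cdot>\<^bsub>D\<^esub> farr F a"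
  then have "\<Phi> X Z g \<cdot>\<^bsub>C\<^esub> a = \<Phi> X Z h \<cdot>\<^bsub>C\<^esub> a"
    using natural_left[OF a g] natural_left[OF a h] by simp
  note X = C.Hom_Cod_Obj[OF a]
  have "\<Phi> X Z g = \<Phi> X Z h"
    using C.epiD[OF epi a adjunct_Hom[OF X g] adjunct_Hom[OF X h]] \<open>\<Phi> X Z g \<cdot>\<^bsub>C\<^esub> a = _\<close> .
  then show "g = h" using adjunct_inject[OF X g h] by blast
qed

text \<open>Families of arrows out of the \<open>fobj F (X j)\<close> into \<open>Y\<close>
  correspond under \<Phi> to families out of the \<open>X j\<close> into \<open>fobj G Y\<close>,
  where the universal property of \<open>S\<close> applies.\<close>

lemma left_adjoint_coproduct:
  assumes S: "is_coproduct C I X S \<iota>"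
  shows "is_coproduct D I (\<lambda>j. fobj F (X j)) (fobj F S) (\<lambda>j. farr F (\<iota> j))"
proof -
  have SO: "S \<in> Obj C" and XO: "\<And>j. j \<in> I \<Longrightarrow> X j \<in> Obj C"
    using S by (auto simp: is_coproduct_def)
  note \<iota> = C.coproduct_injection[OF S]
  have "\<exists>!h. h \<in> Hom D (fobj F S) Y \<and> (\<forall>j\<in>I. h \<cdot>\<^bsub>D\<^esub> farr F (\<iota> j) = g j)"
    if Y: "Y \<in> Obj D" and g: "\<forall>j\<in>I. g j \<in> Hom D (fobj F (X j)) Y" for Y g
  proof -
    \<comment> \<open>Naturality translates the condition at each injection; injectivity of \<Phi>
      gives the way back.\<close>
    have eq: "h \<cdot>\<^bsub>D\<^esub> farr F (\<iota> j) = g j \<longleftrightarrow> \<Phi> S Y h \<cdot>\<^bsub>C\<^esub> \<iota> j = \<Phi> (X j) Y (g j)"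
      if h: "h \<in> Hom D (fobj F S) Y" and j: "j \<in> I" for h j
      using natural_left[OF \<iota>[OF j] h] adjunct_inject[OF XO[OF j] _ bspec[OF g j]]
        D.Comp_in_Hom[OF functor_Hom[OF F \<iota>[OF j]] h] by metis
    obtain k where k: "k \<in> Hom C S (fobj G Y)" "\<And>j. j \<in> I \<Longrightarrow> k \<cdot>\<^bsub>C\<^esub> \<iota> j = \<Phi> (X j) Y (g j)"
      using C.coproduct_factor[OF S functor_Obj[OF G Y], of "\<lambda>j. \<Phi> (X j) Y (g j)"]
        adjunct_Hom[OF XO] g by blast
    obtain h where h: "h \<in> Hom D (fobj F S) Y" "\<Phi> S Y h = k"
      using adjunct_surject[OF Y k(1)] .
    have "\<forall>j\<in>I. h \<cdot>\<^bsub>D\<^esub> farr F (\<iota> j) = g j" using eq[OF h(1)] h(2) k(2) by simp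
    moreover have "h' = h" if h': "h' \<in> Hom D (fobj F S) Y"
      and e: "\<forall>j\<in>I. h' \<cdot>\<^bsub>D\<^esub> farr F (\<iota> j) = g j" for h'
    proof -
      have "\<Phi> S Y h' = k"
        using C.coproduct_eqI[OF S adjunct_Hom[OF SO h'] k(1)] eq[OF h'] e k(2) by simp
      then show ?thesis using adjunct_inject[OF SO h' h(1)] h(2) by simp
    qed
    ultimately show ?thesis using h(1) by blast
  qed
  then show ?thesis
    using functor_Obj[OF F SO] functor_Obj[OF F XO] functor_Hom[OF F \<iota>]
    unfolding is_coproduct_def by blast
qed

text \<open>Each direction uses the characterisation that fits its naturality law: coconstancy
  passes from \<open>C\<close> to \<open>D\<close> through postcomposition, constancy passes from
  \<open>D\<close> to \<open>C\<close> through precomposition. Additivity of \<Phi> never has to be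
  established.\<close>

lemma zero_arrow_adjunct:
  assumes "abelian_category C" "abelian_category D"
    and X: "X \<in> Obj C" and f: "f \<in> Hom D (fobj F X) Y"
  shows "zero_arrow C (\<Phi> X Y f) \<longleftrightarrow> zero_arrow D f"
proof -
  obtain addC zeroC where "abelian_cat C addC zeroC" using abelian_catI[OF assms(1)] .
  then interpret CA: abelian_cat C addC zeroC .
  obtain addD zeroD where "abelian_cat D addD zeroD" using abelian_catI[OF assms(2)] .
  then interpret DA: abelian_cat D addD zeroD .
  note \<Phi>f = adjunct_Hom[OF X f]
  show ?thesis
  proof
    assume z: "zero_arrow C (\<Phi> X Y f)"
    have "g \<cdot>\<^bsub>D\<^esub> f = h \<cdot>\<^bsub>D\<^esub> f" if g: "g \<in> Hom D Y W" and h: "h \<in> Hom D Y W" for W g h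
    proof (rule adjunct_inject[OF X D.Comp_in_Hom[OF f g] D.Comp_in_Hom[OF f h]])
      show "\<Phi> X W (g \<cdot>\<^bsub>D\<^esub> f) = \<Phi> X W (h \<cdot>\<^bsub>D\<^esub> f)"
        using natural_right[OF X f g] natural_right[OF X f h]
          z[unfolded CA.zero_arrow_iff_coconstant[OF \<Phi>f]] functor_Hom[OF G g] functor_Hom[OF G h]
        by metis
    qed
    then show "zero_arrow D f" using DA.zero_arrow_iff_coconstant[OF f] by blast
  next
    assume z: "zero_arrow D f"
    have "\<Phi> X Y f \<cdot>\<^bsub>C\<^esub> g = \<Phi> X Y f \<cdot>\<^bsub>C\<^esub> h" if g: "g \<in> Hom C W X" and h: "h \<in> Hom C W X" for W g h
      using natural_left[OF g f] natural_left[OF h f]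
        z[unfolded DA.zero_arrow_iff_constant[OF f]] functor_Hom[OF F g] functor_Hom[OF F h]
      by metis
    then show "zero_arrow C (\<Phi> X Y f)" using CA.zero_arrow_iff_constant[OF \<Phi>f] by blast
  qed
qed

text \<open>The adjunct is \<open>farr G f\<close> after the unit, so \<open>farr G f\<close> is epi
  as its last factor, and the faithful functor \<open>G\<close> reflects this.\<close>

lemma epi_adjunct:
  assumes Gf: "faithful_functor D C G" and X: "X \<in> Obj C" and f: "f \<in> Hom D (fobj F X) Y"
    and epi: "is_epi C (\<Phi> X Y f)"
  shows "is_epi D f"
  using epi adjunct_eq_unit[OF X f] C.epi_cancel[OF unit_Hom[OF X] functor_Hom[OF G f]]
    faithful_reflects_epi[OF Gf f] by simp

end

text \<open>One natural bijection is chosen. The object bounds in the naturality clause follow from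
  membership in the Hom sets, which is why the locale states naturality without them.\<close>

lemma left_adjointE:
  assumes "left_adjoint C D F G"
  obtains \<Phi> where "adjunction C D F G \<Phi>"
proof -
  have FG: "is_functor C D F" "is_functor D C G" using assms by (auto simp: left_adjoint_def)
  interpret C: category C using FG by (simp add: is_functor_def)
  interpret D: category D using FG by (simp add: is_functor_def)
  obtain \<Phi> where \<Phi>: "\<forall>X \<in> Obj C. \<forall>Y \<in> Obj D.
      bij_betw (\<Phi> X Y) (Hom D (fobj F X) Y) (Hom C X (fobj G Y))"
    "\<forall>X \<in> Obj C. \<forall>X' \<in> Obj C. \<forall>Y \<in> Obj D. \<forall>Y' \<in> Obj D.
          \<forall>a \<in> Hom C X' X. \<forall>f \<in> Hom D (fobj F X) Y. \<forall>b \<in> Hom D Y Y'.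
            \<Phi> X' Y' (b \<cdot>\<^bsub>D\<^esub> f \<cdot>\<^bsub>D\<^esub> farr F a) = farr G b \<cdot>\<^bsub>C\<^esub> \<Phi> X Y f \<cdot>\<^bsub>C\<^esub> a"
    using assms unfolding left_adjoint_def by blast
  have "adjunction C D F G \<Phi>"
  proof
    fix a X' X f Y b Y'
    assume a: "a \<in> Hom C X' X" and f: "f \<in> Hom D (fobj F X) Y" and b: "b \<in> Hom D Y Y'"
    note O = C.Hom_Dom_Obj[OF a] C.Hom_Cod_Obj[OF a] D.Hom_Dom_Obj[OF b] D.Hom_Cod_Obj[OF b]
    show "\<Phi> X' Y' (b \<cdot>\<^bsub>D\<^esub> f \<cdot>\<^bsub>D\<^esub> farr F a) = farr G b \<cdot>\<^bsub>C\<^esub> \<Phi> X Y f \<cdot>\<^bsub>C\<^esub> a"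
      using \<Phi>(2) O a f b by blast
  qed (use FG \<Phi>(1) in auto)
  then show ?thesis using that by blast
qed

section \<open>Cleft extensions\<close>

text \<open>\<Psi> is the bijection for \<open>l\<close> and \<open>e\<close>, \<Phi> the one for
  \<open>q\<close> and \<open>i\<close>. Facts about the category \<open>B\<close> are cited with
  prefix \<open>le.C\<close>, those about \<open>A\<close> with prefix \<open>le.D\<close>.\<close>

locale cleft =
  le: adjunction B A l e \<Psi> + qi: adjunction A B q i \<Phi>
  for B :: "('ob, 'mb) cat" and A :: "('oa, 'ma) cat"
    and i l :: "('ob, 'mb, 'oa, 'ma) fctr" and e q :: "('oa, 'ma, 'ob, 'mb) fctr"
    and \<Psi> :: "'ob \<Rightarrow> 'oa \<Rightarrow> 'ma \<Rightarrow> 'mb" and \<Phi> :: "'oa \<Rightarrow> 'ob \<Rightarrow> 'mb \<Rightarrow> 'ma" +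
  fixes \<phi> :: "'ob \<Rightarrow> 'mb"
  assumes faithful: "faithful_functor A B e"
    and \<phi>: "natural_isomorphism B B (e \<circ>\<^sub>F i) id_functor \<phi>"
begin

section \<open>The functor \<open>i\<close> and the unit of its left adjoint\<close>

lemma \<phi>_Hom: "X \<in> Obj B \<Longrightarrow> \<phi> X \<in> Hom B (fobj e (fobj i X)) X"
  and \<phi>_iso: "X \<in> Obj B \<Longrightarrow> is_iso B (\<phi> X)"
  using \<phi> by (auto simp: natural_isomorphism_def comp_functor_def id_functor_def)

lemma \<phi>_natural: "f \<in> Hom B X Y \<Longrightarrow> \<phi> Y \<cdot>\<^bsub>B\<^esub> farr e (farr i f) = f \<cdot>\<^bsub>B\<^esub> \<phi> X"
  using \<phi> le.C.Hom_Dom_Obj[of f X Y] le.C.Hom_Cod_Obj[of f X Y]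
  by (auto simp: natural_isomorphism_def comp_functor_def id_functor_def)

text \<open>By naturality of \<phi>, \<open>farr i f\<close> determines
  \<open>f \<cdot> \<phi> X\<close>, and the isomorphism \<open>\<phi> X\<close> cancels.\<close>

lemma faithful_i: "faithful_functor B A i"
  unfolding faithful_functor_def
proof (intro conjI ballI inj_onI)
  show "is_functor B A i" by (rule qi.G)
  fix X Y f g assume f: "f \<in> Hom B X Y" and g: "g \<in> Hom B X Y" and "farr i f = farr i g"
  then have eq: "f \<cdot>\<^bsub>B\<^esub> \<phi> X = g \<cdot>\<^bsub>B\<^esub> \<phi> X" using \<phi>_natural[OF f] \<phi>_natural[OF g] by simp
  note X = le.C.Hom_Dom_Obj[OF f]
  show "f = g"
    using le.C.epiD[OF le.C.iso_epi[OF \<phi>_Hom[OF X] \<phi>_iso[OF X]] \<phi>_Hom[OF X] f g eq] .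
qed

text \<open>Through \<phi> the arrow \<open>farr e (farr i f)\<close> is isomorphic to
  \<open>f\<close>, hence epi, and the faithful functor \<open>e\<close> reflects
  epimorphisms.\<close>

lemma i_epi:
  assumes f: "f \<in> Hom B X Y" and epi: "is_epi B f"
  shows "is_epi A (farr i f)"
proof -
  note X = le.C.Hom_Dom_Obj[OF f] and Y = le.C.Hom_Cod_Obj[OF f]
  note eif = functor_Hom[OF le.G functor_Hom[OF qi.G f]]
  have "is_epi B (f \<cdot>\<^bsub>B\<^esub> \<phi> X)"
    using le.C.epi_comp[OF \<phi>_Hom[OF X] le.C.iso_epi[OF \<phi>_Hom[OF X] \<phi>_iso[OF X]] f epi] .
  then have \<phi>eif: "is_epi B (\<phi> Y \<cdot>\<^bsub>B\<^esub> farr e (farr i f))" using \<phi>_natural[OF f] by simp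
  have "is_epi B (farr e (farr i f))"
  proof -
    have eq: "farr e (farr i f) = inv_arr B (\<phi> Y) \<cdot>\<^bsub>B\<^esub> (\<phi> Y \<cdot>\<^bsub>B\<^esub> farr e (farr i f))"
      using le.C.Comp_assoc[OF eif \<phi>_Hom[OF Y] le.C.inv_arr(1)[OF \<phi>_Hom[OF Y] \<phi>_iso[OF Y]]]
        le.C.inv_arr(2)[OF \<phi>_Hom[OF Y] \<phi>_iso[OF Y]] le.C.Ident_left[OF eif] by simp
    note inv = le.C.inv_arr[OF \<phi>_Hom[OF Y] \<phi>_iso[OF Y]]
    have "is_epi B (inv_arr B (\<phi> Y))"
      using le.C.epi_cancel[OF \<phi>_Hom[OF Y] inv(1)] inv(2)
        le.C.Ident_epi[OF le.C.Hom_Dom_Obj[OF \<phi>_Hom[OF Y]]] by simp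
    then show ?thesis
      using le.C.epi_comp[OF le.C.Comp_in_Hom[OF eif \<phi>_Hom[OF Y]] \<phi>eif inv(1)] eq by simp
  qed
  then show ?thesis using faithful_reflects_epi[OF faithful functor_Hom[OF qi.G f]] by blast
qed

text \<open>The adjunct of the unit is epi because the composite
  \<open>Hom(q l X, Z) \<rightarrow> Hom(l X, i Z) \<rightarrow> Hom(X, e i Z) \<rightarrow> Hom(X, Z)\<close> is injective and, by naturality,
  is precomposition with the image of the identity.\<close>

lemma unit_l_epi:
  assumes X: "X \<in> Obj B"
  shows "is_epi A (qi.unit (fobj l X))"
proof -
  define Y u where "Y = fobj q (fobj l X)" and "u = qi.unit (fobj l X)"
  note lX = functor_Obj[OF le.F X]
  have Y: "Y \<in> Obj B" using functor_Obj[OF qi.F lX] by (simp add: Y_def)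
  have u: "u \<in> Hom A (fobj l X) (fobj i Y)" using qi.unit_Hom[OF lX] by (simp add: u_def Y_def)
  define v where "v = \<Psi> X (fobj i Y) u"
  have v: "v \<in> Hom B X (fobj e (fobj i Y))" using le.adjunct_Hom[OF X u] by (simp add: v_def)
  have "is_epi B v"
  proof (rule le.C.epiI[OF v])
    fix Z a b assume a: "a \<in> Hom B (fobj e (fobj i Y)) Z" and b: "b \<in> Hom B (fobj e (fobj i Y)) Z"
      and eq: "a \<cdot>\<^bsub>B\<^esub> v = b \<cdot>\<^bsub>B\<^esub> v"
    note Z = le.C.Hom_Cod_Obj[OF a]
    note \<phi>Y = \<phi>_Hom[OF Y] \<phi>_iso[OF Y] and \<phi>Z = \<phi>_Hom[OF Z] \<phi>_iso[OF Z]
    \<comment> \<open>Every arrow out of \<open>e i Y\<close> comes from one out of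
      \<open>Y = q l X\<close> along \<open>\<phi> Y\<close>, which makes the adjunction bijection
      \<Phi> applicable.\<close>
    have surj: "\<exists>g\<in>Hom B Y Z. c = g \<cdot>\<^bsub>B\<^esub> \<phi> Y" if "c \<in> Hom B (fobj e (fobj i Y)) Z" for c
      using le.C.Comp_iso_bij_betw[OF \<phi>Y] that unfolding bij_betw_def by (metis imageE)
    obtain g where g: "g \<in> Hom B Y Z" "a = g \<cdot>\<^bsub>B\<^esub> \<phi> Y" using surj[OF a] by blast
    obtain h where h: "h \<in> Hom B Y Z" "b = h \<cdot>\<^bsub>B\<^esub> \<phi> Y" using surj[OF b] by blast
    have expand: "(k \<cdot>\<^bsub>B\<^esub> \<phi> Y) \<cdot>\<^bsub>B\<^esub> v = \<phi> Z \<cdot>\<^bsub>B\<^esub> \<Psi> X (fobj i Z) (\<Phi> (fobj l X) Z k)"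
      if k: "k \<in> Hom B Y Z" for k
    proof -
      note ik = functor_Hom[OF qi.G k]
      have "\<Psi> X (fobj i Z) (\<Phi> (fobj l X) Z k) = farr e (farr i k) \<cdot>\<^bsub>B\<^esub> v"
        using qi.adjunct_eq_unit[OF lX, folded Y_def, OF k] le.natural_right[OF X u ik]
        by (simp add: u_def v_def)
      then show ?thesis
        using le.C.Comp_assoc[OF v functor_Hom[OF le.G ik] \<phi>Z(1)] \<phi>_natural[OF k] by simp
    qed
    have gH: "g \<in> Hom B (fobj q (fobj l X)) Z" and hH: "h \<in> Hom B (fobj q (fobj l X)) Z"
      using g h by (simp_all add: Y_def)
    note \<Phi>g = qi.adjunct_Hom[OF lX gH] and \<Phi>h = qi.adjunct_Hom[OF lX hH]
    have "\<phi> Z \<cdot>\<^bsub>B\<^esub> \<Psi> X (fobj i Z) (\<Phi> (fobj l X) Z g) = \<phi> Z \<cdot>\<^bsub>B\<^esub> \<Psi> X (fobj i Z) (\<Phi> (fobj l X) Z h)"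
      using expand[OF g(1)] expand[OF h(1)] eq g h by simp
    then have "\<Psi> X (fobj i Z) (\<Phi> (fobj l X) Z g) = \<Psi> X (fobj i Z) (\<Phi> (fobj l X) Z h)"
      using le.C.iso_left_cancel[OF \<phi>Z le.adjunct_Hom[OF X \<Phi>g] le.adjunct_Hom[OF X \<Phi>h]] by blast
    then have "\<Phi> (fobj l X) Z g = \<Phi> (fobj l X) Z h"
      using le.adjunct_inject[OF X \<Phi>g \<Phi>h] by blast
    then have "g = h" using qi.adjunct_inject[OF lX gH hH] by blast
    then show "a = b" using g h by simp
  qed
  \<comment> \<open>\<open>v\<close> is the adjunct of the unit under \<open>l\<close> and
    \<open>e\<close>, so its being epi passes to the unit.\<close>
  then show ?thesis using le.epi_adjunct[OF faithful X u] by (simp add: u_def v_def)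
qed

lemma unit_epi:
  assumes X: "X \<in> Obj A"
  shows "is_epi A (qi.unit X)"
proof -
  note eX = functor_Obj[OF le.G X]
  \<comment> \<open>The counit at \<open>X\<close>, obtained as the arrow whose adjunct is the
    identity; it is epi because the identity is.\<close>
  obtain \<epsilon> where \<epsilon>: "\<epsilon> \<in> Hom A (fobj l (fobj e X)) X" "\<Psi> (fobj e X) X \<epsilon> = Ident B (fobj e X)"
    using le.adjunct_surject[OF X le.C.Ident_in_Hom[OF eX]] .
  have "is_epi A \<epsilon>"
    using le.epi_adjunct[OF faithful eX \<epsilon>(1)] le.C.Ident_epi[OF eX] \<epsilon>(2) by simp
  note q\<epsilon> = functor_Hom[OF qi.F \<epsilon>(1)]
  have "is_epi A (farr i (farr q \<epsilon>))"
    using i_epi[OF q\<epsilon> qi.left_adjoint_epi[OF \<epsilon>(1) \<open>is_epi A \<epsilon>\<close>]] .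
  then have "is_epi A (farr i (farr q \<epsilon>) \<cdot>\<^bsub>A\<^esub> qi.unit (fobj l (fobj e X)))"
    using le.D.epi_comp[OF qi.unit_Hom[OF functor_Obj[OF le.F eX]] unit_l_epi[OF eX]
        functor_Hom[OF qi.G q\<epsilon>]] by blast
  then show ?thesis
    using qi.unit_natural[OF \<epsilon>(1)] le.D.epi_cancel[OF \<epsilon>(1) qi.unit_Hom[OF X]] by simp
qed

text \<open>From left to right, \<open>i\<close> turns a coproduct of copies of \<open>q X\<close>
  into one of copies of \<open>i q X\<close>, which the units cover by a coproduct of copies of
  \<open>X\<close>. From right to left, \<open>q\<close> preserves the coproduct, and the adjunct of
  an epimorphism onto \<open>i Y\<close> is epi since \<open>i\<close> is faithful.\<close>

lemma Gen_q:
  assumes coprod: "has_coproducts U A" and pres: "preserves_coproducts U B A i"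
    and X: "X \<in> Obj A" and Y: "Y \<in> Obj B"
  shows "Y \<in> Gen U B (fobj q X) \<longleftrightarrow> fobj i Y \<in> Gen U A X"
proof
  assume "Y \<in> Gen U B (fobj q X)"
  then obtain I S \<iota> p where I: "I \<in> U" and S: "is_coproduct B I (\<lambda>_. fobj q X) S \<iota>"
    and p: "p \<in> Hom B S Y" "is_epi B p"
    by (auto simp: Gen_def)
  have iS: "is_coproduct A I (\<lambda>_. fobj i (fobj q X)) (fobj i S) (\<lambda>j. farr i (\<iota> j))"
    using pres I S unfolding preserves_coproducts_def by blast
  obtain T \<kappa> where T: "is_coproduct A I (\<lambda>_. X) T \<kappa>"
    using spec[OF bspec[OF coprod[unfolded has_coproducts_def] I], of "\<lambda>_. X"] X by auto
  have \<iota>: "farr i (\<iota> j) \<cdot>\<^bsub>A\<^esub> qi.unit X \<in> Hom A X (fobj i S)" if "j \<in> I" for j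
    using le.D.Comp_in_Hom[OF qi.unit_Hom[OF X] le.D.coproduct_injection[OF iS that]] .
  obtain h where h: "h \<in> Hom A T (fobj i S)"
    "\<And>j. j \<in> I \<Longrightarrow> h \<cdot>\<^bsub>A\<^esub> \<kappa> j = farr i (\<iota> j) \<cdot>\<^bsub>A\<^esub> qi.unit X"
    by (rule le.D.coproduct_factor[OF T functor_Obj[OF qi.G le.C.Hom_Dom_Obj[OF p(1)]],
          where g = "\<lambda>j. farr i (\<iota> j) \<cdot>\<^bsub>A\<^esub> qi.unit X"]) (use \<iota> in auto)
  have "is_epi A h"
    by (rule le.D.coproduct_map_epi[OF T iS, where p = "\<lambda>_. qi.unit X"])
      (use h qi.unit_Hom[OF X] unit_epi[OF X] in auto)
  then have "is_epi A (farr i p \<cdot>\<^bsub>A\<^esub> h)"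
    using le.D.epi_comp[OF h(1) _ functor_Hom[OF qi.G p(1)] i_epi[OF p]] by blast
  then show "fobj i Y \<in> Gen U A X"
    using GenI[OF functor_Obj[OF qi.G Y] I T]
      le.D.Comp_in_Hom[OF h(1) functor_Hom[OF qi.G p(1)]] by blast
next
  assume "fobj i Y \<in> Gen U A X"
  then obtain I S \<iota> p where I: "I \<in> U" and S: "is_coproduct A I (\<lambda>_. X) S \<iota>"
    and p: "p \<in> Hom A S (fobj i Y)" "is_epi A p"
    by (auto simp: Gen_def)
  obtain p' where p': "p' \<in> Hom B (fobj q S) Y" "\<Phi> S Y p' = p"
    using qi.adjunct_surject[OF Y p(1)] .
  have "is_epi B p'"
    using qi.epi_adjunct[OF faithful_i le.D.Hom_Dom_Obj[OF p(1)] p'(1)] p'(2) p(2) by simp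
  then show "Y \<in> Gen U B (fobj q X)"
    using GenI[OF Y I qi.left_adjoint_coproduct[OF S] p'(1)] by blast
qed

end

section \<open>Transport of the presentation and of \<open>D_class\<close> along
  \<open>q\<close>\<close>

locale cleft_presentation = cleft B A i l e q \<Psi> \<Phi> \<phi>
  for B :: "('ob, 'mb) cat" and A :: "('oa, 'ma) cat"
    and i l :: "('ob, 'mb, 'oa, 'ma) fctr" and e q :: "('oa, 'ma, 'ob, 'mb) fctr"
    and \<Psi> \<Phi> \<phi> +
  fixes \<theta> :: "'ob \<Rightarrow> 'mb" and P Q :: 'ob and \<delta> :: 'ma and \<sigma> :: 'mb
  assumes abelian_A: "abelian_category A" and abelian_B: "abelian_category B"
    and \<theta>: "natural_isomorphism B B (q \<circ>\<^sub>F l) id_functor \<theta>"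
    and P: "P \<in> Obj B" and Q: "Q \<in> Obj B"
    and \<delta>: "\<delta> \<in> Hom A (fobj l P) (fobj l Q)"
  defines "\<sigma> \<equiv> \<theta> Q \<cdot>\<^bsub>B\<^esub> farr q \<delta> \<cdot>\<^bsub>B\<^esub> inv_arr B (\<theta> P)"
begin

lemma \<theta>_Hom: "X \<in> Obj B \<Longrightarrow> \<theta> X \<in> Hom B (fobj q (fobj l X)) X"
  and \<theta>_iso: "X \<in> Obj B \<Longrightarrow> is_iso B (\<theta> X)"
  using \<theta> by (auto simp: natural_isomorphism_def comp_functor_def id_functor_def)

text \<open>The bijection from Hom(X, L) to Hom(l X, i L) obtained from \<open>q l\<close> \<cong>
  Id followed by the adjunction of \<open>q\<close> and \<open>i\<close>.\<close>

definition transpose :: "'ob \<Rightarrow> 'ob \<Rightarrow> 'mb \<Rightarrow> 'ma" where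
  "transpose X L g = \<Phi> (fobj l X) L (g \<cdot>\<^bsub>B\<^esub> \<theta> X)"

lemma transpose_bij:
  assumes X: "X \<in> Obj B" and L: "L \<in> Obj B"
  shows "bij_betw (transpose X L) (Hom B X L) (Hom A (fobj l X) (fobj i L))"
  using bij_betw_trans[OF le.C.Comp_iso_bij_betw[OF \<theta>_Hom[OF X] \<theta>_iso[OF X]]
      qi.bij[OF functor_Obj[OF le.F X] L]]
  by (simp add: transpose_def[abs_def] comp_def)

lemma transpose_Hom:
  "X \<in> Obj B \<Longrightarrow> g \<in> Hom B X L \<Longrightarrow> transpose X L g \<in> Hom A (fobj l X) (fobj i L)"
  using bij_betw_apply[OF transpose_bij] le.C.Hom_Cod_Obj by blast

lemma q\<delta>: "farr q \<delta> \<in> Hom B (fobj q (fobj l P)) (fobj q (fobj l Q))"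
  using functor_Hom[OF qi.F \<delta>] .

lemma \<sigma>_Hom: "\<sigma> \<in> Hom B P Q"
  unfolding \<sigma>_def
  using le.C.Comp_in_Hom[OF le.C.inv_arr(1)[OF \<theta>_Hom[OF P] \<theta>_iso[OF P]]
      le.C.Comp_in_Hom[OF q\<delta> \<theta>_Hom[OF Q]]] .

text \<open>The square that characterises \<sigma> as \<open>q(\<delta>)\<close> read through
  \<theta>; it removes the inverse of \<open>\<theta> P\<close> from later computations.\<close>

lemma \<sigma>_\<theta>: "\<sigma> \<cdot>\<^bsub>B\<^esub> \<theta> P = \<theta> Q \<cdot>\<^bsub>B\<^esub> farr q \<delta>"
proof -
  note k = le.C.inv_arr[OF \<theta>_Hom[OF P] \<theta>_iso[OF P]]
  note c = le.C.Comp_in_Hom[OF q\<delta> \<theta>_Hom[OF Q]]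
  show ?thesis unfolding \<sigma>_def
    using le.C.Comp_assoc[OF \<theta>_Hom[OF P] k(1) c] k(2) le.C.Ident_right[OF c] by simp
qed

lemma transpose_\<sigma>:
  assumes g: "g \<in> Hom B Q L"
  shows "transpose P L (g \<cdot>\<^bsub>B\<^esub> \<sigma>) = transpose Q L g \<cdot>\<^bsub>A\<^esub> \<delta>"
proof -
  have "(g \<cdot>\<^bsub>B\<^esub> \<sigma>) \<cdot>\<^bsub>B\<^esub> \<theta> P = (g \<cdot>\<^bsub>B\<^esub> \<theta> Q) \<cdot>\<^bsub>B\<^esub> farr q \<delta>"
    using le.C.Comp_assoc[OF \<theta>_Hom[OF P] \<sigma>_Hom g] le.C.Comp_assoc[OF q\<delta> \<theta>_Hom[OF Q] g] \<sigma>_\<theta>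
    by simp
  then show ?thesis
    using qi.natural_left[OF \<delta> le.C.Comp_in_Hom[OF \<theta>_Hom[OF Q] g]] by (simp add: transpose_def)
qed

text \<open>The bijections \<open>transpose\<close> identify precomposition with \<sigma> and
  precomposition with \<delta>, so one map is surjective exactly when the other is.\<close>

lemma D_class_iff:
  assumes L: "L \<in> Obj B"
  shows "L \<in> D_class B \<sigma> \<longleftrightarrow> fobj i L \<in> D_class A \<delta>"
proof
  assume D: "L \<in> D_class B \<sigma>"
  have "\<exists>g\<in>Hom A (fobj l Q) (fobj i L). g \<cdot>\<^bsub>A\<^esub> \<delta> = f"
    if f: "f \<in> Hom A (fobj l P) (fobj i L)" for f
  proof -
    obtain f' where f': "f' \<in> Hom B P L" "transpose P L f' = f"
      using transpose_bij[OF P L] f unfolding bij_betw_def by (metis imageE)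
    obtain g where "g \<in> Hom B Q L" "g \<cdot>\<^bsub>B\<^esub> \<sigma> = f'" using le.C.D_classD[OF D \<sigma>_Hom f'(1)] .
    then show ?thesis using transpose_\<sigma> f'(2) transpose_Hom[OF Q] by metis
  qed
  then show "fobj i L \<in> D_class A \<delta>"
    using le.D.D_classI[OF functor_Obj[OF qi.G L] \<delta>] by blast
next
  assume D: "fobj i L \<in> D_class A \<delta>"
  have "\<exists>g\<in>Hom B Q L. g \<cdot>\<^bsub>B\<^esub> \<sigma> = f" if f: "f \<in> Hom B P L" for f
  proof -
    obtain g where g: "g \<in> Hom A (fobj l Q) (fobj i L)" "g \<cdot>\<^bsub>A\<^esub> \<delta> = transpose P L f"
      using le.D.D_classD[OF D \<delta> transpose_Hom[OF P f]] .
    obtain g' where g': "g' \<in> Hom B Q L" "transpose Q L g' = g"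
      using transpose_bij[OF Q L] g(1) unfolding bij_betw_def by (metis imageE)
    have "transpose P L (g' \<cdot>\<^bsub>B\<^esub> \<sigma>) = transpose P L f" using transpose_\<sigma>[OF g'(1)] g' g by simp
    then have "g' \<cdot>\<^bsub>B\<^esub> \<sigma> = f"
      using transpose_bij[OF P L] f le.C.Comp_in_Hom[OF \<sigma>_Hom g'(1)]
      by (auto simp: bij_betw_def dest: inj_onD)
    then show ?thesis using g'(1) by blast
  qed
  then show "L \<in> D_class B \<sigma>" using le.C.D_classI[OF L \<sigma>_Hom] by blast
qed

text \<open>A left adjoint preserves cokernels. Transposition turns \<open>h \<cdot> \<rho>\<close>
  into \<open>\<Phi> X L h \<cdot> \<pi>\<close>, so factoring \<open>g\<close> through \<rho>
  amounts to factoring its transpose through \<pi>.\<close>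

lemma cokernel_q:
  assumes \<pi>: "\<pi> \<in> Hom A (fobj l Q) X" and cok: "is_cokernel A \<delta> \<pi>"
  defines "\<rho> \<equiv> farr q \<pi> \<cdot>\<^bsub>B\<^esub> inv_arr B (\<theta> Q)"
  shows "\<rho> \<in> Hom B Q (fobj q X)" and "is_cokernel B \<sigma> \<rho>"
proof -
  note k = le.C.inv_arr[OF \<theta>_Hom[OF Q] \<theta>_iso[OF Q]]
  note X = le.D.Hom_Cod_Obj[OF \<pi>]
  note q\<pi> = functor_Hom[OF qi.F \<pi>]
  note lP = functor_Obj[OF le.F P] and lQ = functor_Obj[OF le.F Q]
  show \<rho>: "\<rho> \<in> Hom B Q (fobj q X)" unfolding \<rho>_def using le.C.Comp_in_Hom[OF k(1) q\<pi>] .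
  have \<rho>\<theta>: "\<rho> \<cdot>\<^bsub>B\<^esub> \<theta> Q = farr q \<pi>"
    unfolding \<rho>_def using le.C.Comp_assoc[OF \<theta>_Hom[OF Q] k(1) q\<pi>] k(2) le.C.Ident_right[OF q\<pi>]
    by simp
  have transpose_\<rho>: "transpose Q L (h \<cdot>\<^bsub>B\<^esub> \<rho>) = \<Phi> X L h \<cdot>\<^bsub>A\<^esub> \<pi>"
    if h: "h \<in> Hom B (fobj q X) L" for h L
    using le.C.Comp_assoc[OF \<theta>_Hom[OF Q] \<rho> h] \<rho>\<theta> qi.natural_left[OF \<pi> h]
    by (simp add: transpose_def)
  obtain addB zeroB where "abelian_cat B addB zeroB" using abelian_catI[OF abelian_B] .
  then interpret BA: abelian_cat B addB zeroB .
  \<comment> \<open>Both stages of the transposition, composing with the isomorphism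
    \<open>\<theta> P\<close> and passing to the adjunct, preserve and reflect zero arrows.\<close>
  have zero_iff: "zero_arrow B f \<longleftrightarrow> zero_arrow A (transpose P L f)" if f: "f \<in> Hom B P L" for f L
  proof -
    note f\<theta> = le.C.Comp_in_Hom[OF \<theta>_Hom[OF P] f]
    note kP = le.C.inv_arr[OF \<theta>_Hom[OF P] \<theta>_iso[OF P]]
    have "f = (f \<cdot>\<^bsub>B\<^esub> \<theta> P) \<cdot>\<^bsub>B\<^esub> inv_arr B (\<theta> P)"
      using le.C.Comp_assoc[OF kP(1) \<theta>_Hom[OF P] f] kP(3) le.C.Ident_right[OF f] by simp
    then have "zero_arrow B f \<longleftrightarrow> zero_arrow B (f \<cdot>\<^bsub>B\<^esub> \<theta> P)"
      using BA.zero_arrow_Comp_right[OF _ \<theta>_Hom[OF P] f] BA.zero_arrow_Comp_right[OF _ kP(1) f\<theta>]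
      by metis
    then show ?thesis
      using qi.zero_arrow_adjunct[OF abelian_A abelian_B lP f\<theta>] by (simp add: transpose_def)
  qed
  have doms: "Dom A \<delta> = fobj l P" "Cod A \<delta> = fobj l Q" "Cod A \<pi> = X" "Dom B \<sigma> = P" "Cod B \<sigma> = Q"
    "Dom B \<rho> = Q" "Cod B \<rho> = fobj q X"
    using \<delta> \<pi> \<sigma>_Hom \<rho> by (auto simp: Hom_def)
  obtain addA zeroA where "abelian_cat A addA zeroA" using abelian_catI[OF abelian_A] .
  then interpret AA: abelian_cat A addA zeroA .
  have "zero_arrow B (\<rho> \<cdot>\<^bsub>B\<^esub> \<sigma>)"
  proof -
    have qX: "fobj q X \<in> Obj B" using functor_Obj[OF qi.F X] .
    \<comment> \<open>The transpose of \<rho> is the unit after \<pi>, so that of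
      \<open>\<rho> \<cdot> \<sigma>\<close> ends up as the unit after the zero arrow
      \<open>\<pi> \<cdot> \<delta>\<close>.\<close>
    have "transpose Q (fobj q X) \<rho> = qi.unit X \<cdot>\<^bsub>A\<^esub> \<pi>"
      using qi.adjunct_farr[OF \<pi>] \<rho>\<theta> by (simp add: transpose_def)
    then have "transpose P (fobj q X) (\<rho> \<cdot>\<^bsub>B\<^esub> \<sigma>) = qi.unit X \<cdot>\<^bsub>A\<^esub> (\<pi> \<cdot>\<^bsub>A\<^esub> \<delta>)"
      using transpose_\<sigma>[OF \<rho>] le.D.Comp_assoc[OF \<delta> \<pi> qi.unit_Hom[OF X]] by simp
    moreover have "zero_arrow A (\<pi> \<cdot>\<^bsub>A\<^esub> \<delta>)" using cok by (simp add: is_cokernel_def)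
    ultimately show ?thesis
      using zero_iff[OF le.C.Comp_in_Hom[OF \<sigma>_Hom \<rho>]]
        AA.zero_arrow_Comp_left[OF _ le.D.Comp_in_Hom[OF \<delta> \<pi>] qi.unit_Hom[OF X]] by simp
  qed
  moreover have "\<exists>!h. h \<in> Hom B (fobj q X) L \<and> h \<cdot>\<^bsub>B\<^esub> \<rho> = g"
    if L: "L \<in> Obj B" and g: "g \<in> Hom B Q L" and z: "zero_arrow B (g \<cdot>\<^bsub>B\<^esub> \<sigma>)" for L g
  proof -
    have eq: "h \<cdot>\<^bsub>B\<^esub> \<rho> = g \<longleftrightarrow> \<Phi> X L h \<cdot>\<^bsub>A\<^esub> \<pi> = transpose Q L g" if h: "h \<in> Hom B (fobj q X) L" for h
      using transpose_\<rho>[OF h] transpose_bij[OF Q L] g le.C.Comp_in_Hom[OF \<rho> h]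
      unfolding bij_betw_def by (metis inj_onD)
    have "zero_arrow A (transpose Q L g \<cdot>\<^bsub>A\<^esub> \<delta>)"
      using z zero_iff[OF le.C.Comp_in_Hom[OF \<sigma>_Hom g]] transpose_\<sigma>[OF g] by simp
    then have ex: "\<exists>!h. h \<in> Hom A X (fobj i L) \<and> h \<cdot>\<^bsub>A\<^esub> \<pi> = transpose Q L g"
      using cok functor_Obj[OF qi.G L] transpose_Hom[OF Q g] unfolding is_cokernel_def doms by blast
    then obtain h where h: "h \<in> Hom A X (fobj i L)" "h \<cdot>\<^bsub>A\<^esub> \<pi> = transpose Q L g" by blast
    obtain h' where h': "h' \<in> Hom B (fobj q X) L" "\<Phi> X L h' = h"
      using qi.adjunct_surject[OF L h(1)] .
    have "h'' = h'" if h'': "h'' \<in> Hom B (fobj q X) L" "h'' \<cdot>\<^bsub>B\<^esub> \<rho> = g" for h''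
    proof -
      have "\<Phi> X L h'' = h" using ex eq[OF h''(1)] h''(2) h qi.adjunct_Hom[OF X h''(1)] by blast
      then show ?thesis using qi.adjunct_inject[OF X h''(1) h'(1)] h'(2) by simp
    qed
    then show ?thesis using h'(1) eq[OF h'(1)] h'(2) h(2) by blast
  qed
  ultimately show "is_cokernel B \<sigma> \<rho>"
    using le.C.Arr_of_Hom[OF \<sigma>_Hom] le.C.Arr_of_Hom[OF \<rho>]
    unfolding is_cokernel_def doms by blast
qed

text \<open>Exactness of a presentation is the same as \<pi> being a cokernel of \<delta>, and it is
  in this form that \<open>q\<close> transports it.\<close>

lemma projective_presentation_q:
  assumes "projective_presentation A \<delta> \<pi> X" and "projective B P" and "projective B Q"
  shows "projective_presentation B \<sigma> (farr q \<pi> \<cdot>\<^bsub>B\<^esub> inv_arr B (\<theta> Q)) (fobj q X)"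
proof -
  obtain addA zeroA where "abelian_cat A addA zeroA" using abelian_catI[OF abelian_A] .
  then interpret AA: abelian_cat A addA zeroA .
  obtain addB zeroB where "abelian_cat B addB zeroB" using abelian_catI[OF abelian_B] .
  then interpret BA: abelian_cat B addB zeroB .
  have "\<pi> \<in> Hom A (fobj l Q) X" "is_cokernel A \<delta> \<pi>"
    using assms(1) \<delta> AA.exact_epi_cokernel unfolding projective_presentation_def
    by (auto simp: Hom_def)
  from cokernel_q[OF this] show ?thesis
    using \<sigma>_Hom assms BA.cokernel_exact le.C.cokernel_epi unfolding projective_presentation_def
    by (auto simp: Hom_def)
qed

section \<open>Torsion classes and generated classes in \<open>B\<close>\<close>

lemma torsion_class_q:
  assumes pres: "preserves_coproducts U B A i" and PQ: "projective B Q"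
    and tors: "torsion_class U A (D_class A \<delta>)"
  shows "torsion_class U B (D_class B \<sigma>)"
  unfolding torsion_class_def
proof (intro conjI allI impI ballI)
  show "D_class B \<sigma> \<subseteq> Obj B" by (auto simp: D_class_def)
next
  fix p assume p: "is_epi B p \<and> Dom B p \<in> D_class B \<sigma>"
  then have pH: "p \<in> Hom B (Dom B p) (Cod B p)" by (auto simp: is_epi_def Hom_def)
  have ip: "farr i p \<in> Hom A (fobj i (Dom B p)) (fobj i (Cod B p))"
    using functor_Hom[OF qi.G pH] .
  \<comment> \<open>Quotients are tested in \<open>A\<close>, because \<open>i\<close> preserves
    epimorphisms.\<close>
  have "fobj i (Dom B p) \<in> D_class A \<delta>" using p D_class_iff[OF le.C.Hom_Dom_Obj[OF pH]] by blast
  then have "fobj i (Cod B p) \<in> D_class A \<delta>"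
    using tors i_epi[OF pH] p ip unfolding torsion_class_def Hom_def by fastforce
  then show "Cod B p \<in> D_class B \<sigma>" using D_class_iff[OF le.C.Hom_Cod_Obj[OF pH]] by blast
next
  \<comment> \<open>Closure under extensions is obtained directly in \<open>B\<close> from
    projectivity of \<open>Q\<close>, without moving short exact sequences along
    \<open>i\<close>.\<close>
  obtain addB zeroB where "abelian_cat B addB zeroB" using abelian_catI[OF abelian_B] .
  then interpret BA: abelian_cat B addB zeroB .
  fix f g assume "short_exact B f g \<and> Dom B f \<in> D_class B \<sigma> \<and> Cod B g \<in> D_class B \<sigma>"
  then show "Cod B f \<in> D_class B \<sigma>" using BA.D_class_extension[OF \<sigma>_Hom PQ] by blast
next
  fix I X S \<iota> assume I: "I \<in> U" and S: "is_coproduct B I X S \<iota> \<and> (\<forall>j\<in>I. X j \<in> D_class B \<sigma>)"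
  then have "S \<in> Obj B" "\<forall>j\<in>I. X j \<in> Obj B" by (auto simp: is_coproduct_def)
  moreover have "is_coproduct A I (\<lambda>j. fobj i (X j)) (fobj i S) (\<lambda>j. farr i (\<iota> j))"
    using pres I S unfolding preserves_coproducts_def by blast
  moreover have "\<forall>j\<in>I. fobj i (X j) \<in> D_class A \<delta>"
    using S D_class_iff \<open>\<forall>j\<in>I. X j \<in> Obj B\<close> by blast
  ultimately have "fobj i S \<in> D_class A \<delta>"
    using tors I unfolding torsion_class_def by blast
  then show "S \<in> D_class B \<sigma>" using D_class_iff[OF \<open>S \<in> Obj B\<close>] by blast
qed

text \<open>The unit exhibits \<open>i q X\<close> as a quotient of \<open>X\<close>, and the
  torsion class of \<delta> is closed under quotients.\<close>

lemma q_in_D_class: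
  assumes X: "X \<in> D_class A \<delta>" and tors: "torsion_class U A (D_class A \<delta>)"
  shows "fobj q X \<in> D_class B \<sigma>"
proof -
  have XO: "X \<in> Obj A" using X by (simp add: D_class_def)
  have "fobj i (fobj q X) \<in> D_class A \<delta>"
    using tors X unit_epi[OF XO] qi.unit_Hom[OF XO] unfolding torsion_class_def Hom_def
    by fastforce
  then show ?thesis using D_class_iff[OF functor_Obj[OF qi.F XO]] by blast
qed

text \<open>For an object \<open>Y\<close> both memberships are equivalent to statements about
  \<open>i Y\<close> that agree by assumption.\<close>

lemma Gen_q_eq_D_class:
  assumes "has_coproducts U A" and "preserves_coproducts U B A i" and "X \<in> Obj A"
    and "Gen U A X = D_class A \<delta>"
  shows "Gen U B (fobj q X) = D_class B \<sigma>"
proof (rule Set.set_eqI)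
  fix Y show "Y \<in> Gen U B (fobj q X) \<longleftrightarrow> Y \<in> D_class B \<sigma>"
  proof (cases "Y \<in> Obj B")
    case True
    then show ?thesis using Gen_q[OF assms(1-3)] D_class_iff assms(4) by blast
  next
    case False
    then show ?thesis by (simp add: Gen_def D_class_def)
  qed
qed

end

section \<open>Silting and partial silting objects under \<open>q\<close>\<close>

theorem theorem3p8:
  fixes \<A> :: "('oa, 'ma) cat" and \<B> :: "('ob, 'mb) cat"
    and U :: "'i set set"
    and i l :: "('ob, 'mb, 'oa, 'ma) fctr" and e q :: "('oa, 'ma, 'ob, 'mb) fctr"
    and \<theta> :: "'ob \<Rightarrow> 'mb" and A :: 'oa and P\<^sub>0 P\<^sub>1 :: 'ob and \<delta> \<pi> :: 'ma
  assumes "abelian_category \<A>" and "enough_projectives \<A>" and "enough_injectives \<A>"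
    and "has_coproducts U \<A>"
    and "abelian_category \<B>" and "enough_projectives \<B>" and "enough_injectives \<B>"
    and "has_coproducts U \<B>"
    and "cleft_extension \<B> \<A> i e l"
    and "preserves_coproducts U \<B> \<A> i"
    and "left_adjoint \<A> \<B> q i"
    and "natural_isomorphism \<B> \<B> (q \<circ>\<^sub>F l) id_functor \<theta>"
    and "A \<in> Obj \<A>"
    and "projective \<B> P\<^sub>0" and "projective \<B> P\<^sub>1"
    and "\<delta> \<in> Hom \<A> (fobj l P\<^sub>1) (fobj l P\<^sub>0)"
    and "projective_presentation \<A> \<delta> \<pi> A"
  shows "let \<sigma> = \<theta> P\<^sub>0 \<cdot>\<^bsub>\<B>\<^esub> farr q \<delta> \<cdot>\<^bsub>\<B>\<^esub> inv_arr \<B> (\<theta> P\<^sub>1);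
             \<rho> = farr q \<pi> \<cdot>\<^bsub>\<B>\<^esub> inv_arr \<B> (\<theta> P\<^sub>0)
         in \<sigma> \<in> Hom \<B> P\<^sub>1 P\<^sub>0 \<and> projective_presentation \<B> \<sigma> \<rho> (fobj q A) \<and>
            (silting U \<A> A \<delta> \<longrightarrow> silting U \<B> (fobj q A) \<sigma>) \<and>
            (partial_silting U \<A> A \<delta> \<longrightarrow> partial_silting U \<B> (fobj q A) \<sigma>)"
proof -
  obtain \<Psi> where \<Psi>: "adjunction \<B> \<A> l e \<Psi>"
    using assms(9) by (auto simp: cleft_extension_def elim: left_adjointE)
  obtain \<Phi> where \<Phi>: "adjunction \<A> \<B> q i \<Phi>"
    using left_adjointE[OF assms(11)] .
  obtain \<phi> where \<phi>: "natural_isomorphism \<B> \<B> (e \<circ>\<^sub>F i) id_functor \<phi>"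
    using assms(9) by (auto simp: cleft_extension_def)
  have P: "P\<^sub>1 \<in> Obj \<B>" "P\<^sub>0 \<in> Obj \<B>" using assms(14,15) by (auto simp: projective_def)
  have faithful: "faithful_functor \<A> \<B> e" using assms(9) by (simp add: cleft_extension_def)
  \<comment> \<open>\<open>P\<close> and \<open>Q\<close> of the locale are the source index
    \<open>P\<^sub>1\<close> and the target index \<open>P\<^sub>0\<close>.\<close>
  interpret cleft_presentation \<B> \<A> i l e q \<Psi> \<Phi> \<phi> \<theta> P\<^sub>1 P\<^sub>0 \<delta>
    "\<theta> P\<^sub>0 \<cdot>\<^bsub>\<B>\<^esub> farr q \<delta> \<cdot>\<^bsub>\<B>\<^esub> inv_arr \<B> (\<theta> P\<^sub>1)"
    unfolding cleft_presentation_def cleft_presentation_axioms_def cleft_def cleft_axioms_def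
    using \<Psi> \<Phi> \<phi> faithful assms(1,5,12,16) P by auto
  have pp: "projective_presentation \<B> (\<theta> P\<^sub>0 \<cdot>\<^bsub>\<B>\<^esub> farr q \<delta> \<cdot>\<^bsub>\<B>\<^esub> inv_arr \<B> (\<theta> P\<^sub>1))
      (farr q \<pi> \<cdot>\<^bsub>\<B>\<^esub> inv_arr \<B> (\<theta> P\<^sub>0)) (fobj q A)"
    using projective_presentation_q assms(14,15,17) by blast
  \<comment> \<open>Both silting notions ask for some presentation; \<open>pp\<close> supplies it,
    with the cokernel map built from \<open>farr q \<pi>\<close> as witness.\<close>
  show ?thesis
    unfolding Let_def silting_def partial_silting_def
    using \<sigma>_Hom pp Gen_q_eq_D_class[OF assms(4,10,13)] q_in_D_class
      torsion_class_q[OF assms(10,14)] by blast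
qed

end
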